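(* Let $\mathsf{A}$ be a $C^*$-algebra with character $\chi$ and let $\varphi$ be a $\chi$-structure map on $\mathsf{A}$. Then $\varphi$ is implemented.
   Context: A character is a nonzero multiplicative linear functional. A $\chi$-structure map on $\mathsf{A}$ is a linear map $\varphi:\mathsf{A}\to B(\mathbb{C}\oplus\mathsf{h})$, for some Hilbert space $\mathsf{h}$ (no continuity assumed), satisfying \[ \varphi(a^*b)=\varphi(a)^*\chi(b)+\overline{\chi(a)}\,\varphi(b)+\varphi(a)^*\Delta\varphi(b)\qquad(a,b\in\mathsf{A}), \] where $\Delta=\begin{bmatrix}0&0\\0&I_{\mathsf{h}}\end{bmatrix}$ is the orthogonal projection onto $\{0\}\oplus\mathsf{h}$. It is implemented if there is a $C^*$-representation ( *-homomorphism) $\pi:\mathsf{A}\to B(\mathsf{h})$ and a vector $\xi\in\mathsf{h}$ such that \[ \varphi(a)=\begin{bmatrix}\langle\xi|\\ I_{\mathsf{h}}\end{bmatrix}\big(\pi(a)-\chi(a)I_{\mathsf{h}}\big)\begin{bmatrix}|\xi\rangle& I_{\mathsf{h}}\end{bmatrix}\qquad(a\in\mathsf{A}), \] where $|\xi\rangle:\mathbb{C}\to\mathsf{h}$, $z\mapsto z\xi$, and $\langle\xi|:\mathsf{h}\to\mathbb{C}$, $\eta\mapsto\langle\xi,\eta\rangle$ (inner products linear in the second argument). *)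

theory Defs
  imports "HOL-Analysis.Analysis"
begin

section \<open>Complex Hilbert spaces\<close>

class complex_vector = real_vector +
  fixes scaleC :: "complex \<Rightarrow> 'a \<Rightarrow> 'a" (infixr \<open>*\<^sub>C\<close> 75)
  assumes scaleC_add_right: "c *\<^sub>C (x + y) = c *\<^sub>C x + c *\<^sub>C y"
    and scaleC_add_left: "(b + c) *\<^sub>C x = b *\<^sub>C x + c *\<^sub>C x"
    and scaleC_scaleC: "b *\<^sub>C c *\<^sub>C x = (b * c) *\<^sub>C x"
    and scaleR_scaleC: "r *\<^sub>R x = complex_of_real r *\<^sub>C x"

text \<open>
  Inner products are conjugate-linear in the first and linear in the second argument.
  Positive definiteness of \<open>cinner\<close>, and the fact that it induces the norm, come
  from \<open>inner_Re_cinner\<close> and the axioms of \<^class>\<open>real_inner\<close>.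
\<close>

class complex_inner = complex_vector + real_inner +
  fixes cinner :: "'a \<Rightarrow> 'a \<Rightarrow> complex"
  assumes cinner_commute: "cinner x y = cnj (cinner y x)"
    and cinner_add_right: "cinner x (y + z) = cinner x y + cinner x z"
    and cinner_scaleC_right: "cinner x (c *\<^sub>C y) = c * cinner x y"
    and inner_Re_cinner: "inner x y = Re (cinner x y)"

class chilbert_space = complex_inner + complete_space

lemma cinner_self: "complex_of_real ((norm x)\<^sup>2) = cinner x x"
proof -
  have "Im (cinner x x) = 0"
    using arg_cong[OF cinner_commute[of x x], of Im] by simp
  then show ?thesis
    by (simp add: complex_eq_iff power2_norm_eq_inner inner_Re_cinner)
qed

instantiation complex :: chilbert_space
begin
definition scaleC_complex :: "complex \<Rightarrow> complex \<Rightarrow> complex"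
  where "scaleC_complex c z = c * z"
definition cinner_complex :: "complex \<Rightarrow> complex \<Rightarrow> complex"
  where "cinner_complex w z = cnj w * z"
instance
  by standard
    (simp_all add: scaleC_complex_def cinner_complex_def algebra_simps scaleR_conv_of_real
      inner_complex_def)
end

text \<open>The Hilbert space direct sum is the product type, with its library norm.\<close>

instantiation prod :: (complex_vector, complex_vector) complex_vector
begin
definition scaleC_prod :: "complex \<Rightarrow> 'a \<times> 'b \<Rightarrow> 'a \<times> 'b"
  where "scaleC_prod c v = (c *\<^sub>C fst v, c *\<^sub>C snd v)"
instance
  by standard
    (simp_all add: scaleC_prod_def prod_eq_iff scaleC_add_right scaleC_add_left scaleC_scaleC
      scaleR_scaleC)
end

instantiation prod :: (complex_inner, complex_inner) complex_inner
begin
definition cinner_prod :: "'a \<times> 'b \<Rightarrow> 'a \<times> 'b \<Rightarrow> complex"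
  where "cinner_prod v w = cinner (fst v) (fst w) + cinner (snd v) (snd w)"
instance
proof
  fix x y z :: "'a \<times> 'b" and c :: complex
  show "cinner x y = cnj (cinner y x)"
    unfolding cinner_prod_def
    using cinner_commute[of "fst x" "fst y"] cinner_commute[of "snd x" "snd y"] by simp
  show "cinner x (y + z) = cinner x y + cinner x z"
    by (simp add: cinner_prod_def cinner_add_right)
  show "cinner x (c *\<^sub>C y) = c * cinner x y"
    by (simp add: cinner_prod_def scaleC_prod_def cinner_scaleC_right algebra_simps)
  show "inner x y = Re (cinner x y)"
    by (simp add: cinner_prod_def inner_prod_def inner_Re_cinner)
qed
end

instance prod :: (chilbert_space, chilbert_space) chilbert_space ..


section \<open>Bounded operators and adjoints\<close>

definition bounded_clinear :: "('a::complex_inner \<Rightarrow> 'b::complex_inner) \<Rightarrow> bool"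
  where "bounded_clinear T \<longleftrightarrow> bounded_linear T \<and> (\<forall>c x. T (c *\<^sub>C x) = c *\<^sub>C T x)"

text \<open>Meaningful for bounded operators on Hilbert spaces only; see \<open>cinner_cadjoint\<close>.\<close>

definition cadjoint :: "('a::complex_inner \<Rightarrow> 'b::complex_inner) \<Rightarrow> 'b \<Rightarrow> 'a"
  where "cadjoint T = (SOME S. \<forall>x y. cinner (T x) y = cinner x (S y))"

lemma riesz_real:
  fixes g :: "'a::{real_inner, complete_space} \<Rightarrow> real"
  assumes "bounded_linear g"
  shows "\<exists>w. \<forall>x. g x = inner w x"
proof -
  interpret bounded_linear g by fact
  define J where "J x = inner x x - 2 * g x" for x
  obtain K where K: "\<And>x. norm (g x) \<le> norm x * K"
    using bounded by blast
  have lower: "- (K\<^sup>2) \<le> J x" for x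
  proof -
    have "g x \<le> norm x * K" using K[of x] by simp
    moreover have "0 \<le> (norm x - K)\<^sup>2" by simp
    ultimately show ?thesis
      by (simp add: J_def power2_norm_eq_inner[symmetric] power2_diff)
  qed
  define d where "d = Inf (range J)"
  have bdd: "bdd_below (range J)" using lower by (auto intro!: bdd_belowI)
  have d_le: "d \<le> J x" for x unfolding d_def by (rule cInf_lower[OF _ bdd]) simp
  have "\<exists>x. J x < d + inverse (real (Suc n))" for n
  proof -
    have "\<exists>y\<in>range J. y < d + inverse (real (Suc n))"
      unfolding d_def by (rule cInf_lessD) auto
    then show ?thesis by blast
  qed
  then obtain X where X: "\<And>n. J (X n) < d + inverse (real (Suc n))" by metis
  have par: "(norm (x - y))\<^sup>2 = 2 * J x + 2 * J y - 4 * J ((1/2) *\<^sub>R (x + y))" for x y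
    by (simp add: J_def power2_norm_eq_inner add scaleR inner_simps inner_commute algebra_simps)
  have close: "(norm (X m - X n))\<^sup>2 \<le> 4 * inverse (real (Suc N))" if "N \<le> m" "N \<le> n" for m n N
  proof -
    have "inverse (real (Suc m)) \<le> inverse (real (Suc N))"
      "inverse (real (Suc n)) \<le> inverse (real (Suc N))"
      using that by (simp_all add: le_imp_inverse_le)
    then show ?thesis
      using par[of "X m" "X n"] X[of m] X[of n] d_le[of "(1/2) *\<^sub>R (X m + X n)"] by linarith
  qed
  have "Cauchy X"
  proof (rule CauchyI)
    fix e :: real assume e: "0 < e"
    then obtain N where "inverse (real (Suc N)) < e\<^sup>2 / 4"
      using reals_Archimedean[of "e\<^sup>2 / 4"] by auto
    then have "(norm (X m - X n))\<^sup>2 < e\<^sup>2" if "N \<le> m" "N \<le> n" for m n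
      using close[OF that] by linarith
    then show "\<exists>N. \<forall>m\<ge>N. \<forall>n\<ge>N. norm (X m - X n) < e"
      using e power_less_imp_less_base[of _ 2 e] by (metis less_imp_le)
  qed
  then obtain w where w: "X \<longlonglongrightarrow> w" using Cauchy_convergent convergentD by blast
  have "(\<lambda>n. J (X n)) \<longlonglongrightarrow> J w"
    unfolding J_def by (intro tendsto_intros w tendsto)
  moreover have "(\<lambda>n. d + inverse (real (Suc n))) \<longlonglongrightarrow> d + 0"
    by (intro tendsto_intros LIMSEQ_inverse_real_of_nat)
  ultimately have "J w \<le> d + 0"
    by (rule LIMSEQ_le) (use X less_imp_le in blast)
  then have Jw: "J w \<le> d" by simp
  have "g x = inner w x" for x
  proof (rule ccontr)
    assume ne: "g x \<noteq> inner w x"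
    define s where "s = g x - inner w x"
    define q where "q = inner x x + 1"
    have q: "q > 0" unfolding q_def by (simp add: add_nonneg_pos)
    define t where "t = s / q"
    have "J (w + t *\<^sub>R x) = J w - 2 * t * s + t\<^sup>2 * inner x x"
      by (simp add: J_def s_def add scaleR inner_simps inner_commute power2_eq_square algebra_simps)
    then have "0 \<le> - 2 * t * s + t\<^sup>2 * inner x x"
      using Jw d_le[of "w + t *\<^sub>R x"] by linarith
    also have "\<dots> \<le> - 2 * t * s + t\<^sup>2 * q"
      by (simp add: q_def mult_left_mono)
    also have "\<dots> = - (s\<^sup>2 / q)"
      using q by (simp add: t_def power2_eq_square field_simps)
    also have "\<dots> < 0" using q ne by (simp add: s_def)
    finally show False by simp
  qed
  then show ?thesis by blast
qed

lemma cinner_cadjoint: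
  fixes T :: "'a::chilbert_space \<Rightarrow> 'b::chilbert_space"
  assumes "bounded_clinear T"
  shows "cinner (T x) y = cinner x (cadjoint T y)"
proof -
  have T: "bounded_linear T" "\<And>c x. T (c *\<^sub>C x) = c *\<^sub>C T x"
    using assms by (auto simp: bounded_clinear_def)
  have left: "cinner (c *\<^sub>C u) v = cnj c * cinner u v" for c and u v :: "'c::complex_inner"
    using cinner_commute[of "c *\<^sub>C u" v] cinner_commute[of u v]
    by (simp add: cinner_scaleC_right)
  have "\<exists>z. \<forall>x. cinner (T x) y = cinner x z" for y
  proof -
    have "bounded_linear (\<lambda>x. inner (T x) y)"
      by (rule bounded_linear_compose[OF bounded_linear_inner_left T(1)])
    then obtain z where z: "\<And>x. inner (T x) y = inner z x" using riesz_real by blast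
    have Re: "Re (cinner (T x) y) = Re (cinner x z)" for x
      using z[of x] by (simp add: inner_Re_cinner[symmetric] inner_commute)
    have "Im (cinner (T x) y) = Im (cinner x z)" for x
      using Re[of "\<i> *\<^sub>C x"] by (simp add: T(2) left)
    with Re show ?thesis by (auto simp: complex_eq_iff)
  qed
  then have "\<forall>y. \<exists>z. \<forall>x. cinner (T x) y = cinner x z" by simp
  from choice[OF this] have "\<exists>S. \<forall>x y. cinner (T x) y = cinner x (S y)" by auto
  then have "\<forall>x y. cinner (T x) y = cinner x (cadjoint T y)"
    unfolding cadjoint_def by (rule someI_ex)
  then show ?thesis by (elim allE)
qed

lemma cadjoint_unique:
  fixes T :: "'a::chilbert_space \<Rightarrow> 'b::chilbert_space"
  assumes "\<And>x y. cinner (T x) y = cinner x (S y)"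
  shows "cadjoint T = S"
proof
  fix y
  have "\<exists>S. \<forall>x y. cinner (T x) y = cinner x (S y)"
    by (intro exI[of _ S] allI assms)
  then have *: "\<forall>x y. cinner (T x) y = cinner x (cadjoint T y)"
    unfolding cadjoint_def by (rule someI_ex)
  have "cinner x (cadjoint T y) = cinner x (S y)" for x
    by (rule trans[OF *[rule_format, symmetric] assms])
  then have "inner x (cadjoint T y) = inner x (S y)" for x by (simp add: inner_Re_cinner)
  then show "cadjoint T y = S y" using vector_eq_ldot[of "cadjoint T y" "S y"] by simp
qed


section \<open>C*-algebras, characters and representations\<close>

text \<open>No unit is assumed.\<close>

class cstar_algebra = complex_vector + real_normed_algebra + banach +
  fixes star :: "'a \<Rightarrow> 'a" (\<open>_\<^sup>\<star>\<close> [1000] 1000)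
  assumes mult_scaleC_left: "(c *\<^sub>C x) * y = c *\<^sub>C (x * y)"
    and mult_scaleC_right: "x * (c *\<^sub>C y) = c *\<^sub>C (x * y)"
    and norm_scaleC: "norm (c *\<^sub>C x) = cmod c * norm x"
    and star_star: "(x\<^sup>\<star>)\<^sup>\<star> = x"
    and star_add: "(x + y)\<^sup>\<star> = x\<^sup>\<star> + y\<^sup>\<star>"
    and star_scaleC: "(c *\<^sub>C x)\<^sup>\<star> = cnj c *\<^sub>C x\<^sup>\<star>"
    and star_mult: "(x * y)\<^sup>\<star> = y\<^sup>\<star> * x\<^sup>\<star>"
    and cstar_identity: "norm (x\<^sup>\<star> * x) = (norm x)\<^sup>2"

instantiation complex :: cstar_algebra
begin
definition star_complex :: "complex \<Rightarrow> complex" where "star_complex = cnj"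
instance
  by standard
    (simp_all add: scaleC_complex_def star_complex_def norm_mult power2_eq_square)
end

definition character :: "('a::cstar_algebra \<Rightarrow> complex) \<Rightarrow> bool"
  where "character chi \<longleftrightarrow>
    (\<forall>a b. chi (a + b) = chi a + chi b) \<and>
    (\<forall>c a. chi (c *\<^sub>C a) = c * chi a) \<and>
    (\<forall>a b. chi (a * b) = chi a * chi b) \<and>
    (\<exists>a. chi a \<noteq> 0)"

definition operator_linear ::
    "('a::complex_vector \<Rightarrow> 'b::complex_inner \<Rightarrow> 'b) \<Rightarrow> bool"
  where "operator_linear \<phi> \<longleftrightarrow>
    (\<forall>a. bounded_clinear (\<phi> a)) \<and>
    (\<forall>a b. \<phi> (a + b) = (\<lambda>v. \<phi> a v + \<phi> b v)) \<and>
    (\<forall>c a. \<phi> (c *\<^sub>C a) = (\<lambda>v. c *\<^sub>C \<phi> a v))"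

text \<open>Representations may be degenerate.\<close>

definition cstar_representation ::
    "('a::cstar_algebra \<Rightarrow> 'h::chilbert_space \<Rightarrow> 'h) \<Rightarrow> bool"
  where "cstar_representation \<pi> \<longleftrightarrow>
    operator_linear \<pi> \<and>
    (\<forall>a b. \<pi> (a * b) = \<pi> a \<circ> \<pi> b) \<and>
    (\<forall>a. \<pi> (a\<^sup>\<star>) = cadjoint (\<pi> a))"


section \<open>Structure maps\<close>

definition Delta :: "complex \<times> 'h::chilbert_space \<Rightarrow> complex \<times> 'h"
  where "Delta = (\<lambda>(z, \<eta>). (0, \<eta>))"

definition structure_map ::
    "('a::cstar_algebra \<Rightarrow> complex) \<Rightarrow>
     ('a \<Rightarrow> complex \<times> 'h::chilbert_space \<Rightarrow> complex \<times> 'h) \<Rightarrow> bool"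
  where "structure_map chi \<phi> \<longleftrightarrow>
    operator_linear \<phi> \<and>
    (\<forall>a b. \<phi> (a\<^sup>\<star> * b) =
      (\<lambda>v. chi b *\<^sub>C cadjoint (\<phi> a) v
         + cnj (chi a) *\<^sub>C \<phi> b v
         + cadjoint (\<phi> a) (Delta (\<phi> b v))))"

definition ket :: "'h::chilbert_space \<Rightarrow> complex \<Rightarrow> 'h"
  where "ket \<xi> = (\<lambda>z. z *\<^sub>C \<xi>)"

definition bra :: "'h::chilbert_space \<Rightarrow> 'h \<Rightarrow> complex"
  where "bra \<xi> = (\<lambda>\<eta>. cinner \<xi> \<eta>)"

definition implemented ::
    "('a::cstar_algebra \<Rightarrow> complex) \<Rightarrow>
     ('a \<Rightarrow> complex \<times> 'h::chilbert_space \<Rightarrow> complex \<times> 'h) \<Rightarrow> bool"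
  where "implemented chi \<phi> \<longleftrightarrow>
    (\<exists>(\<pi> :: 'a \<Rightarrow> 'h \<Rightarrow> 'h) (\<xi> :: 'h).
      cstar_representation \<pi> \<and>
      (\<forall>a. \<phi> a =
        (\<lambda>\<eta>. (bra \<xi> \<eta>, \<eta>)) \<circ> (\<lambda>\<eta>. \<pi> a \<eta> - chi a *\<^sub>C \<eta>) \<circ> (\<lambda>(z, \<eta>). ket \<xi> z + \<eta>)))"

end

theory Submission imports Defs "HOL-Computational_Algebra.Formal_Power_Series" begin

text \<open>
  Split \<open>\<phi> a\<close> along \<open>\<complex> \<oplus> h\<close>: let \<open>\<gamma> a\<close> be the scalar corner, \<open>\<delta> a \<in> h\<close> the image of \<open>1\<close> in \<open>h\<close>, \<open>\<nu> a\<close>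
  the operator corner, and put \<open>\<pi> a = \<nu> a + \<chi> a\<close>. The structure relation says that \<open>\<pi>\<close> is multiplicative,
  that \<open>\<delta>\<close> is a derivation, \<open>\<delta> (a b) = \<pi> a (\<delta> b) + \<chi> b \<delta> a\<close>, and that
  \<open>\<gamma> (a\<^sup>\<star> b) = cnj (\<gamma> a) \<chi> b + cnj (\<chi> a) \<gamma> b + \<langle>\<delta> a, \<delta> b\<rangle>\<close>. What has to be found is a vector \<open>\<xi>\<close> with
  \<open>\<delta> a = (\<pi> a - \<chi> a) \<xi>\<close> and \<open>\<gamma> a = \<langle>\<xi>, \<delta> a\<rangle>\<close>.

  The second equation suggests the proof: by a Riesz argument on the range of \<open>\<delta>\<close> (\<open>riesz_on_range\<close>),
  such a \<open>\<xi>\<close> exists in the closure of that range as soon as the energy \<open>\<parallel>\<delta> b\<parallel>\<^sup>2 - 2 Re (\<gamma> b)\<close> is bounded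
  below, and then the first equation follows by testing against the vectors \<open>\<delta> b\<close>
  (\<open>implementing_vector\<close>). On the ideal \<open>K = ker \<chi>\<close> the last relation reads \<open>\<gamma> (a\<^sup>\<star> a) = \<parallel>\<delta> a\<parallel>\<^sup>2\<close>, so
  \<open>Re \<gamma>\<close> is a positive functional on \<open>K\<close>, and two classical facts about positive functionals
  remain. Such a functional is automatically continuous: otherwise a convergent
  series of positive elements would have an infinite value (\<open>positive_bounded\<close>). And, although \<open>K\<close>
  need not have a unit, \<open>Re \<gamma> ((1 + k)\<^sup>\<star> (1 + k) - 1)\<close> is bounded below for \<open>k \<in> K\<close>, because
  \<open>((1 + k) u)\<^sup>\<star> ((1 + k) u) \<in> K\<close> has a nonnegative value for every \<open>u \<in> K\<close>, in particular for an approximate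
  unit of the form \<open>1 - (1 + l m\<^sup>2)\<^sup>-\<^sup>1\<close> (\<open>energy_bounded_below\<close>).

  The C*-algebra needed for this rests on the binomial series in place of spectra. Square roots of \<open>1 - g\<close>, for
  self-adjoint \<open>g\<close> of norm at most 1, come from the binomial series, which converges
  absolutely up to the boundary (\<open>positive_sqrt\<close>); they give the norm characterization of squares of
  self-adjoint elements, the decomposition of a self-adjoint element into a difference of two such squares
  (\<open>selfadjoint_diff_positive\<close>), and bounds for resolvents.

  These tools want a unit, so the algebra is embedded in its unitization, to which \<open>\<phi>\<close> extends by
  \<open>\<phi> 1 = 0\<close>. The extension satisfies the structure relation only if \<open>\<phi> (a\<^sup>\<star>) = (\<phi> a)\<^sup>\<star>\<close>. On products
  \<open>a\<^sup>\<star> b\<close> this is a consequence of the relation itself, and such products span the algebra by the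
  decomposition into squares (\<open>structure_map_adjoint\<close>).
\<close>

section \<open>Complex vector spaces and involutions\<close>

lemma scaleC_one [simp]: "1 *\<^sub>C (x::'a::complex_vector) = x"
  using scaleR_scaleC[of 1 x] by simp

lemma scaleC_zero_left [simp]: "0 *\<^sub>C (x::'a::complex_vector) = 0"
  using scaleR_scaleC[of 0 x] by simp

lemma scaleC_zero_right [simp]: "c *\<^sub>C (0::'a::complex_vector) = 0"
  using scaleC_add_right[of c 0 0] by simp

lemma scaleC_minus_left: "(- c) *\<^sub>C (x::'a::complex_vector) = - (c *\<^sub>C x)"
  using scaleC_add_left[of c "-c" x] by (simp add: eq_neg_iff_add_eq_0 add.commute)

lemma scaleC_minus_right: "c *\<^sub>C (- x::'a::complex_vector) = - (c *\<^sub>C x)"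
  using scaleC_add_right[of c x "-x"] by (simp add: eq_neg_iff_add_eq_0 add.commute)

lemma scaleC_diff_left: "(b - c) *\<^sub>C (x::'a::complex_vector) = b *\<^sub>C x - c *\<^sub>C x"
  using scaleC_add_left[of b "-c" x] by (simp add: scaleC_minus_left)

lemma scaleC_diff_right: "c *\<^sub>C (x - y::'a::complex_vector) = c *\<^sub>C x - c *\<^sub>C y"
  using scaleC_add_right[of c x "-y"] by (simp add: scaleC_minus_right)

lemmas scaleC_simps = scaleC_add_right scaleC_add_left scaleC_minus_left scaleC_minus_right
  scaleC_diff_left scaleC_diff_right scaleC_scaleC

lemma star_zero [simp]: "(0::'a::cstar_algebra)\<^sup>\<star> = 0"
  using star_add[of 0 "0::'a"] by simp

lemma star_minus: "(- x::'a::cstar_algebra)\<^sup>\<star> = - x\<^sup>\<star>"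
  using star_add[of x "-x"] by (simp add: eq_neg_iff_add_eq_0 add.commute)

lemma star_diff: "(x - y::'a::cstar_algebra)\<^sup>\<star> = x\<^sup>\<star> - y\<^sup>\<star>"
  using star_add[of x "-y"] by (simp add: star_minus)

lemma star_scaleR: "(r *\<^sub>R x::'a::cstar_algebra)\<^sup>\<star> = r *\<^sub>R x\<^sup>\<star>"
  by (simp add: scaleR_scaleC star_scaleC)

lemmas star_simps = star_add star_diff star_minus star_scaleC star_scaleR star_mult star_star

lemma norm_star: "norm ((x::'a::cstar_algebra)\<^sup>\<star>) = norm x"
proof -
  have le: "norm y \<le> norm (y\<^sup>\<star>)" for y :: 'a
  proof (cases "norm y = 0")
    case False
    have "norm y * norm y \<le> norm (y\<^sup>\<star>) * norm y"
      using norm_mult_ineq[of "y\<^sup>\<star>" y] by (simp add: cstar_identity power2_eq_square)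
    then show ?thesis using False by simp
  qed simp
  show ?thesis using le[of x] le[of "x\<^sup>\<star>"] by (simp add: star_star)
qed

lemma bounded_linear_star: "bounded_linear (star :: 'a::cstar_algebra \<Rightarrow> 'a)"
  by (rule bounded_linear_intro[where K = 1]) (simp_all add: star_add star_scaleR norm_star)

section \<open>The unitization\<close>

datatype 'a unitization = Unitization (scalar_part: complex) (alg_part: 'a)

lemma unitization_eq_iff:
  "u = v \<longleftrightarrow> scalar_part u = scalar_part v \<and> alg_part u = alg_part v"
  by (cases u; cases v) simp

text \<open>
  The unitization acts on the ideal by left multiplication. The operator norm of this action
  satisfies the C*-identity, but it is only a seminorm when the algebra already has a unit \<open>e\<close>, since
  then \<open>1 - e\<close> acts as zero. Taking the maximum with the modulus of the scalar part, which is a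
  C*-seminorm too, repairs this and makes one construction serve both cases.
\<close>

definition act :: "'a::cstar_algebra unitization \<Rightarrow> 'a \<Rightarrow> 'a"
  where "act u x = scalar_part u *\<^sub>C x + alg_part u * x"

lemma bounded_linear_act: "bounded_linear (act u)"
proof (rule bounded_linear_intro[where K = "cmod (scalar_part u) + norm (alg_part u)"])
  show "act u (r *\<^sub>R x) = r *\<^sub>R act u x" for r x
    by (simp add: act_def scaleR_scaleC scaleC_simps mult_scaleC_right mult.commute)
  show "norm (act u x) \<le> norm x * (cmod (scalar_part u) + norm (alg_part u))" for x
    unfolding act_def
    by (rule norm_triangle_le)
      (simp add: norm_scaleC distrib_left mult.commute[of "norm x"] norm_mult_ineq)
qed (simp add: act_def scaleC_simps algebra_simps)

instantiation unitization :: (cstar_algebra) complex_vector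
begin

definition zero_unitization_def: "0 = Unitization 0 0"
definition plus_unitization_def:
  "u + v = Unitization (scalar_part u + scalar_part v) (alg_part u + alg_part v)"
definition minus_unitization_def:
  "u - v = Unitization (scalar_part u - scalar_part v) (alg_part u - alg_part v)"
definition uminus_unitization_def: "- u = Unitization (- scalar_part u) (- alg_part u)"
definition scaleR_unitization_def:
  "r *\<^sub>R u = Unitization (r *\<^sub>R scalar_part u) (r *\<^sub>R alg_part u)"
definition scaleC_unitization_def:
  "c *\<^sub>C u = Unitization (c * scalar_part u) (c *\<^sub>C alg_part u)"

lemmas unitization_linear_defs = zero_unitization_def plus_unitization_def minus_unitization_def
  uminus_unitization_def scaleR_unitization_def scaleC_unitization_def

instance proof
  fix u v w :: "'a unitization" and r s :: real and c d :: complex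
  show "u + v + w = u + (v + w)" "u + v = v + u" "0 + u = u" "- u + u = 0" "u - v = u + - v"
    by (simp_all add: unitization_linear_defs algebra_simps)
  show "r *\<^sub>R (u + v) = r *\<^sub>R u + r *\<^sub>R v" "(r + s) *\<^sub>R u = r *\<^sub>R u + s *\<^sub>R u"
    "r *\<^sub>R s *\<^sub>R u = (r * s) *\<^sub>R u" "1 *\<^sub>R u = u"
    by (simp_all add: unitization_linear_defs unitization_eq_iff algebra_simps)
  show "c *\<^sub>C (u + v) = c *\<^sub>C u + c *\<^sub>C v" "(c + d) *\<^sub>C u = c *\<^sub>C u + d *\<^sub>C u"
    "c *\<^sub>C d *\<^sub>C u = (c * d) *\<^sub>C u"
    by (simp_all add: unitization_linear_defs unitization_eq_iff algebra_simps scaleC_simps)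
  show "r *\<^sub>R u = complex_of_real r *\<^sub>C u"
    by (simp add: unitization_linear_defs scaleR_scaleC scaleC_complex_def)
qed

end

lemma act_add: "act (u + v) x = act u x + act v x"
  by (simp add: act_def unitization_linear_defs scaleC_simps algebra_simps)

lemma act_scaleC: "act (c *\<^sub>C u) x = c *\<^sub>C act u x"
  by (simp add: act_def unitization_linear_defs scaleC_simps mult_scaleC_left)

lemma norm_act_le: "norm (act u x) \<le> onorm (act u) * norm x"
  by (rule onorm[OF bounded_linear_act])

lemma onorm_act_nonneg: "0 \<le> onorm (act u)"
  by (rule onorm_pos_le[OF bounded_linear_act])

lemma onorm_act_scaleC: "onorm (act (c *\<^sub>C u)) = cmod c * onorm (act u)"
proof -
  have le: "onorm (act (d *\<^sub>C v)) \<le> cmod d * onorm (act v)" for d and v :: "'a unitization"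
    by (rule onorm_bound)
      (simp_all add: act_scaleC norm_scaleC onorm_act_nonneg mult.assoc mult_left_mono norm_act_le)
  show ?thesis
  proof (cases "c = 0")
    case True
    then show ?thesis using le[of c u] onorm_act_nonneg[of "c *\<^sub>C u"] by simp
  next
    case False
    have "inverse c *\<^sub>C c *\<^sub>C u = u"
      using False by (simp add: unitization_linear_defs unitization_eq_iff scaleC_scaleC)
    then have "cmod c * onorm (act u) \<le> onorm (act (c *\<^sub>C u))"
      using le[of "inverse c" "c *\<^sub>C u"] False
      by (simp add: norm_inverse norm_divide field_simps)
    then show ?thesis using le[of c u] by simp
  qed
qed

instantiation unitization :: (cstar_algebra) real_normed_algebra
begin

definition times_unitization_def:
  "u * v = Unitization (scalar_part u * scalar_part v)
    (scalar_part u *\<^sub>C alg_part v + scalar_part v *\<^sub>C alg_part u + alg_part u * alg_part v)"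
definition norm_unitization_def: "norm u = max (cmod (scalar_part u)) (onorm (act u))"
definition dist_unitization_def: "dist u v = norm (u - v :: 'a unitization)"
definition sgn_unitization_def: "sgn u = inverse (norm u) *\<^sub>R (u :: 'a unitization)"
definition uniformity_unitization_def:
  "(uniformity :: ('a unitization \<times> 'a unitization) filter) =
    (INF e\<in>{0<..}. principal {(u, v). dist u v < e})"
definition open_unitization_def:
  "open (S :: 'a unitization set) \<longleftrightarrow>
    (\<forall>u\<in>S. \<forall>\<^sub>F (u', v) in uniformity. u' = u \<longrightarrow> v \<in> S)"

lemma act_mult: "act (u * v) x = act u (act v x)"
  by (simp add: act_def times_unitization_def scaleC_simps mult_scaleC_left mult_scaleC_right
      algebra_simps)

lemma onorm_act_mult: "onorm (act (u * v)) \<le> onorm (act u) * onorm (act v)"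
proof -
  have "act (u * v) = act u \<circ> act v" by (simp add: fun_eq_iff act_mult)
  then show ?thesis using onorm_compose[OF bounded_linear_act bounded_linear_act] by metis
qed

instance proof
  fix u v w :: "'a unitization" and r s :: real
  show "u * v * w = u * (v * w)" "(u + v) * w = u * w + v * w" "u * (v + w) = u * v + u * w"
    "(r *\<^sub>R u) * v = r *\<^sub>R (u * v)" "u * (r *\<^sub>R v) = r *\<^sub>R (u * v)"
    by (simp_all add: times_unitization_def unitization_linear_defs unitization_eq_iff algebra_simps
      scaleC_simps scaleR_scaleC scaleC_complex_def mult_scaleC_left mult_scaleC_right)
  show "dist u v = norm (u - v)" "sgn u = inverse (norm u) *\<^sub>R u"
    "(uniformity :: ('a unitization \<times> 'a unitization) filter) =
      (INF e\<in>{0<..}. principal {(u, v). dist u v < e})"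
    "\<And>S. open (S :: 'a unitization set) \<longleftrightarrow>
      (\<forall>u\<in>S. \<forall>\<^sub>F (u', v) in uniformity. u' = u \<longrightarrow> v \<in> S)"
    by (rule dist_unitization_def sgn_unitization_def uniformity_unitization_def
        open_unitization_def)+
  show "norm u = 0 \<longleftrightarrow> u = 0"
  proof
    assume n: "norm u = 0"
    have "cmod (scalar_part u) \<le> norm u" "onorm (act u) \<le> norm u"
      by (simp_all add: norm_unitization_def)
    then have s: "scalar_part u = 0" and o: "onorm (act u) = 0"
      using n onorm_act_nonneg[of u] by simp_all
    have "act u x = 0" for x
      using norm_act_le[of u x] o by simp
    from this[of "(alg_part u)\<^sup>\<star>"] have "alg_part u * (alg_part u)\<^sup>\<star> = 0"
      by (simp add: act_def s)
    then have "alg_part u = 0"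
      using cstar_identity[of "(alg_part u)\<^sup>\<star>"] by (simp add: star_star norm_star)
    with s show "u = 0" by (simp add: unitization_linear_defs unitization_eq_iff)
  next
    assume "u = 0"
    then show "norm u = 0"
      by (simp add: norm_unitization_def unitization_linear_defs act_def[abs_def] onorm_zero)
  qed
  show "norm (u + v) \<le> norm u + norm v"
  proof -
    have "onorm (act (u + v)) \<le> onorm (act u) + onorm (act v)"
      using onorm_triangle[OF bounded_linear_act bounded_linear_act, of u v]
      by (simp add: act_add[abs_def])
    moreover have "cmod (scalar_part (u + v)) \<le> cmod (scalar_part u) + cmod (scalar_part v)"
      by (simp add: unitization_linear_defs norm_triangle_ineq)
    ultimately show ?thesis unfolding norm_unitization_def by linarith
  qed
  show "norm (r *\<^sub>R u) = \<bar>r\<bar> * norm u"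
    unfolding scaleR_scaleC norm_unitization_def onorm_act_scaleC
    by (simp add: scaleC_unitization_def norm_mult max_mult_distrib_left)
  show "norm (u * v) \<le> norm u * norm v"
    unfolding norm_unitization_def
  proof (rule max.boundedI)
    show "cmod (scalar_part (u * v)) \<le> max (cmod (scalar_part u)) (onorm (act u)) *
        max (cmod (scalar_part v)) (onorm (act v))"
      unfolding times_unitization_def
      by (simp add: norm_mult mult_mono max_def onorm_act_nonneg)
    show "onorm (act (u * v)) \<le> max (cmod (scalar_part u)) (onorm (act u)) *
        max (cmod (scalar_part v)) (onorm (act v))"
      by (rule order_trans[OF onorm_act_mult]) (intro mult_mono; simp add: onorm_act_nonneg le_max_iff_disj)
  qed
qed

end

instantiation unitization :: (cstar_algebra) cstar_algebra
begin

definition star_unitization_def: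
  "u\<^sup>\<star> = Unitization (cnj (scalar_part u)) ((alg_part u)\<^sup>\<star>)"

lemmas unitization_defs = unitization_linear_defs times_unitization_def star_unitization_def

lemma star_act_mult: "(act u x)\<^sup>\<star> * y = x\<^sup>\<star> * act (u\<^sup>\<star>) y"
  by (simp add: act_def unitization_defs star_simps mult_scaleC_left mult_scaleC_right
      algebra_simps)

text \<open>
  For \<open>v x\<close> in the ideal the C*-identity is available: \<open>\<parallel>v x\<parallel>\<^sup>2 = \<parallel>x\<^sup>\<star> (v\<^sup>\<star> v x)\<parallel>\<close>. This bounds the operator norm
  of \<open>v\<close> by that of \<open>v\<^sup>\<star> v\<close>, and the usual symmetry argument gives equality.
\<close>

lemma onorm_act_star_mult: "onorm (act (u\<^sup>\<star> * u)) = (onorm (act u))\<^sup>2"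
proof -
  have lower: "(onorm (act v))\<^sup>2 \<le> onorm (act (v\<^sup>\<star> * v))" for v :: "'a unitization"
  proof -
    have "norm (act v x) \<le> sqrt (onorm (act (v\<^sup>\<star> * v))) * norm x" for x
    proof (rule power2_le_imp_le)
      have "(norm (act v x))\<^sup>2 = norm (x\<^sup>\<star> * act (v\<^sup>\<star> * v) x)"
        by (simp add: cstar_identity[symmetric] star_act_mult act_mult)
      also have "\<dots> \<le> norm x * (onorm (act (v\<^sup>\<star> * v)) * norm x)"
        by (rule order_trans[OF norm_mult_ineq])
          (simp add: norm_star mult_left_mono norm_act_le)
      finally show "(norm (act v x))\<^sup>2 \<le> (sqrt (onorm (act (v\<^sup>\<star> * v))) * norm x)\<^sup>2"
        by (simp add: power_mult_distrib onorm_act_nonneg power2_eq_square mult_ac)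
    qed (simp add: onorm_act_nonneg)
    then have "onorm (act v) \<le> sqrt (onorm (act (v\<^sup>\<star> * v)))"
      by (intro onorm_bound) (simp_all add: onorm_act_nonneg)
    then show ?thesis
      using power_mono[OF _ onorm_act_nonneg, of v _ 2] by (fastforce simp: onorm_act_nonneg)
  qed
  have star: "onorm (act v) \<le> onorm (act (v\<^sup>\<star>))" for v :: "'a unitization"
  proof (cases "onorm (act v) = 0")
    case False
    then have pos: "0 < onorm (act v)" using onorm_act_nonneg[of v] by linarith
    have "onorm (act v) * onorm (act v) \<le> onorm (act (v\<^sup>\<star>)) * onorm (act v)"
      using order_trans[OF lower onorm_act_mult] by (simp add: power2_eq_square)
    then show ?thesis using pos by simp
  qed (simp add: onorm_act_nonneg)
  have "(u\<^sup>\<star>)\<^sup>\<star> = u" by (simp add: star_unitization_def star_star)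
  then have "onorm (act (u\<^sup>\<star>)) = onorm (act u)" using star[of u] star[of "u\<^sup>\<star>"] by simp
  then show ?thesis
    using lower[of u] onorm_act_mult[of "u\<^sup>\<star>" u] by (simp add: power2_eq_square)
qed

instance proof
  fix u v :: "'a unitization" and c :: complex
  show "(c *\<^sub>C u) * v = c *\<^sub>C (u * v)" "u * (c *\<^sub>C v) = c *\<^sub>C (u * v)"
    by (simp_all add: unitization_defs unitization_eq_iff algebra_simps scaleC_simps
      mult_scaleC_left mult_scaleC_right)
  show "u\<^sup>\<star>\<^sup>\<star> = u" "(u + v)\<^sup>\<star> = u\<^sup>\<star> + v\<^sup>\<star>" "(c *\<^sub>C u)\<^sup>\<star> = cnj c *\<^sub>C u\<^sup>\<star>" "(u * v)\<^sup>\<star> = v\<^sup>\<star> * u\<^sup>\<star>"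
    by (simp_all add: unitization_defs star_simps algebra_simps)
  show "norm (c *\<^sub>C u) = cmod c * norm u"
    unfolding norm_unitization_def onorm_act_scaleC
    by (simp add: scaleC_unitization_def norm_mult max_mult_distrib_left)
  show "norm (u\<^sup>\<star> * u) = (norm u)\<^sup>2"
  proof -
    have "cmod (scalar_part (u\<^sup>\<star> * u)) = (cmod (scalar_part u))\<^sup>2"
      by (simp add: unitization_defs norm_mult power2_eq_square)
    then show ?thesis
      unfolding norm_unitization_def onorm_act_star_mult
      by (simp add: max_def onorm_act_nonneg abs_le_square_iff[symmetric])
  qed
next
  fix X :: "nat \<Rightarrow> 'a unitization"
  assume X: "Cauchy X"
  have D: "Cauchy X \<longleftrightarrow> (\<forall>e>0. \<exists>M. \<forall>m\<ge>M. \<forall>n\<ge>M. norm (X m - X n) < e)"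
    unfolding Cauchy_def dist_unitization_def by simp
  have sle: "cmod (scalar_part u) \<le> norm u" for u :: "'a unitization"
    by (simp add: norm_unitization_def)
  \<comment> \<open>completeness: both coordinates are dominated by the norm, here because \<open>\<parallel>a\<parallel>\<^sup>2 = \<parallel>a a\<^sup>\<star>\<parallel>\<close> and \<open>a a\<^sup>\<star>\<close> is a value of the action up to the scalar part\<close>
  have ale: "norm (alg_part u) \<le> 2 * norm u" for u :: "'a unitization"
  proof (cases "alg_part u = 0")
    case False
    let ?a = "alg_part u"
    have "norm ?a * norm ?a = norm (?a * ?a\<^sup>\<star>)"
      using cstar_identity[of "?a\<^sup>\<star>"] by (simp add: star_star norm_star power2_eq_square)
    also have "?a * ?a\<^sup>\<star> = act u (?a\<^sup>\<star>) - scalar_part u *\<^sub>C ?a\<^sup>\<star>"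
      by (simp add: act_def)
    also have "norm \<dots> \<le> onorm (act u) * norm ?a + cmod (scalar_part u) * norm ?a"
      by (rule order_trans[OF norm_triangle_ineq4])
        (use norm_act_le[of u "?a\<^sup>\<star>"] in \<open>simp add: norm_scaleC norm_star\<close>)
    also have "\<dots> = (onorm (act u) + cmod (scalar_part u)) * norm ?a"
      by (simp add: algebra_simps)
    finally have "norm ?a \<le> onorm (act u) + cmod (scalar_part u)"
      using False by simp
    then show ?thesis unfolding norm_unitization_def by linarith
  qed (simp add: norm_unitization_def le_max_iff_disj)
  have "Cauchy (\<lambda>n. scalar_part (X n))"
  proof (rule CauchyI)
    fix e :: real assume "0 < e"
    then obtain M where M: "\<forall>m\<ge>M. \<forall>n\<ge>M. norm (X m - X n) < e" using X D by blast
    have "norm (scalar_part (X m) - scalar_part (X n)) \<le> norm (X m - X n)" for m n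
      using sle[of "X m - X n"] by (simp add: minus_unitization_def)
    then show "\<exists>M. \<forall>m\<ge>M. \<forall>n\<ge>M. norm (scalar_part (X m) - scalar_part (X n)) < e"
      using M by (meson le_less_trans)
  qed
  then obtain s where s: "(\<lambda>n. scalar_part (X n)) \<longlonglongrightarrow> s"
    using Cauchy_convergent convergentD by blast
  have "Cauchy (\<lambda>n. alg_part (X n))"
  proof (rule CauchyI)
    fix e :: real assume "0 < e"
    then have "0 < e / 2" by simp
    then obtain M where M: "\<forall>m\<ge>M. \<forall>n\<ge>M. norm (X m - X n) < e / 2" using X D by blast
    have "norm (alg_part (X m) - alg_part (X n)) \<le> 2 * norm (X m - X n)" for m n
      using ale[of "X m - X n"] by (simp add: minus_unitization_def)
    then show "\<exists>M. \<forall>m\<ge>M. \<forall>n\<ge>M. norm (alg_part (X m) - alg_part (X n)) < e"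
      using M by (smt (verit) field_sum_of_halves)
  qed
  then obtain a where a: "(\<lambda>n. alg_part (X n)) \<longlonglongrightarrow> a"
    using Cauchy_convergent convergentD by blast
  let ?L = "Unitization s a"
  have bound: "dist (X n) ?L \<le> cmod (scalar_part (X n) - s) + norm (alg_part (X n) - a)" for n
  proof -
    have "onorm (act (X n - ?L)) \<le> cmod (scalar_part (X n) - s) + norm (alg_part (X n) - a)"
    proof (rule onorm_bound)
      fix x
      show "norm (act (X n - ?L) x)
          \<le> (cmod (scalar_part (X n) - s) + norm (alg_part (X n) - a)) * norm x"
        unfolding act_def minus_unitization_def
        by (rule norm_triangle_le) (simp add: norm_scaleC distrib_right norm_mult_ineq)
    qed simp
    then show ?thesis
      unfolding dist_unitization_def norm_unitization_def by (simp add: minus_unitization_def)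
  qed
  have "(\<lambda>n. cmod (scalar_part (X n) - s) + norm (alg_part (X n) - a)) \<longlonglongrightarrow> 0 + 0"
    by (intro tendsto_add tendsto_norm_zero LIM_zero s a)
  then have lim: "(\<lambda>n. cmod (scalar_part (X n) - s) + norm (alg_part (X n) - a)) \<longlonglongrightarrow> 0"
    by simp
  have "(\<lambda>n. dist (X n) ?L) \<longlonglongrightarrow> 0"
    by (rule tendsto_sandwich[OF _ _ tendsto_const lim]) (simp_all add: bound)
  then have "X \<longlonglongrightarrow> ?L" by (rule tendsto_dist_iff[THEN iffD2])
  then show "convergent X" by (rule convergentI)
qed

end

class unital_cstar_algebra = cstar_algebra + real_normed_algebra_1

instantiation unitization :: (cstar_algebra) unital_cstar_algebra
begin
definition one_unitization_def: "1 = Unitization 1 0"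
instance proof
  fix u :: "'a unitization"
  show "1 * u = u" "u * 1 = u"
    by (simp_all add: one_unitization_def unitization_defs)
  show "(0 :: 'a unitization) \<noteq> 1"
    by (simp add: one_unitization_def unitization_defs)
  have "act (1 :: 'a unitization) = (\<lambda>x. x)"
    by (simp add: fun_eq_iff act_def one_unitization_def)
  then show "norm (1 :: 'a unitization) = 1"
    using onorm_id_le[where 'a = 'a]
    by (simp add: norm_unitization_def one_unitization_def max_absorb1)
qed
end

section \<open>Square roots\<close>

text \<open>
  The Taylor coefficients of \<open>sqrt (1 - t)\<close> at \<open>t = 0\<close>. They are \<open>1\<close> followed by nonpositive numbers, and their
  partial sums are nonnegative; this makes the series absolutely convergent on the closed unit ball.
\<close>

definition sqrt_coeff :: "nat \<Rightarrow> real"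
  where "sqrt_coeff n = (- 1) ^ n * ((1 / 2) gchoose n)"

lemma sqrt_coeff_0: "sqrt_coeff 0 = 1"
  by (simp add: sqrt_coeff_def)

lemma sqrt_coeff_convolution:
  "(\<Sum>i\<le>n. sqrt_coeff i * sqrt_coeff (n - i)) = (if n = 0 then 1 else if n = 1 then - 1 else 0)"
proof -
  have "(\<Sum>i\<le>n. sqrt_coeff i * sqrt_coeff (n - i))
      = (\<Sum>i\<le>n. (- 1) ^ n * (((1 / 2) gchoose i) * ((1 / 2) gchoose (n - i))))"
  proof (rule sum.cong)
    fix i assume "i \<in> {..n}"
    then have "(- 1 :: real) ^ n = (- 1) ^ i * (- 1) ^ (n - i)"
      by (simp add: power_add[symmetric])
    then show "sqrt_coeff i * sqrt_coeff (n - i)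
        = (- 1) ^ n * (((1 / 2) gchoose i) * ((1 / 2) gchoose (n - i)))"
      by (simp add: sqrt_coeff_def)
  qed simp
  also have "\<dots> = (- 1) ^ n * (1 gchoose n)"
    using gbinomial_Vandermonde[of "1/2::real" "1/2" n]
    by (simp add: sum_distrib_left[symmetric] atMost_atLeast0)
  also have "(1 gchoose n :: real) = of_nat (1 choose n)"
    using binomial_gbinomial[of 1 n, where 'a = real] by simp
  also have "(- 1) ^ n * of_nat (1 choose n) = (if n = 0 then 1 else if n = 1 then - 1 else 0 :: real)"
    by (cases n; cases "n - 1") auto
  finally show ?thesis .
qed

lemma sqrt_coeff_partial_sum_nonneg: "0 \<le> (\<Sum>i\<le>n. sqrt_coeff i)"
proof -
  have "(\<Sum>i\<le>n. sqrt_coeff i) = (- 1) ^ n * ((- 1 / 2) gchoose n)"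
    using gbinomial_sum_lower_neg[of "1/2::real" n] by (simp add: sqrt_coeff_def mult.commute)
  also have "\<dots> = (1 / 2 + of_nat n - 1) gchoose n"
    by (subst gbinomial_negated_upper) (simp add: power_mult_distrib[symmetric])
  also have "\<dots> \<ge> 0"
    by (auto simp: gbinomial_prod_rev intro!: divide_nonneg_nonneg prod_nonneg)
  finally show ?thesis .
qed

lemma sqrt_coeff_nonpos: "0 < n \<Longrightarrow> sqrt_coeff n \<le> 0"
proof -
  assume "0 < n"
  then obtain m where n: "n = Suc m" by (cases n) auto
  have "sqrt_coeff n = of_nat n - 1 / 2 - 1 gchoose n"
    unfolding sqrt_coeff_def
    by (subst gbinomial_negated_upper) (simp add: power_mult_distrib[symmetric] algebra_simps)
  also have "\<dots> = (\<Prod>i<n. real n - 3 / 2 - real i) / fact n"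
    by (simp add: gbinomial_prod_rev atLeast0LessThan)
  also have "(\<Prod>i<n. real n - 3 / 2 - real i) = (\<Prod>i<m. real n - 3 / 2 - real i) * (- 1 / 2)"
    by (simp add: n)
  also have "\<dots> / fact n \<le> 0"
  proof -
    have "0 \<le> (\<Prod>i<m. real n - 3 / 2 - real i)"
      by (intro prod_nonneg) (simp add: n)
    then show ?thesis by (simp add: divide_nonpos_pos)
  qed
  finally show ?thesis .
qed

lemma summable_sqrt_coeff: "summable (\<lambda>n. \<bar>sqrt_coeff n\<bar>)"
proof (rule summableI_nonneg_bounded)
  fix n
  show "(\<Sum>i<n. \<bar>sqrt_coeff i\<bar>) \<le> 2"
  proof (cases n)
    case (Suc m)
    have "(\<Sum>i\<le>m. \<bar>sqrt_coeff i\<bar>) + (\<Sum>i\<le>m. sqrt_coeff i) = (\<Sum>i\<le>m. if i = 0 then 2 else 0)"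
      unfolding sum.distrib[symmetric]
      by (intro sum.cong) (auto simp: sqrt_coeff_0 abs_of_nonpos sqrt_coeff_nonpos)
    then show ?thesis
      using sqrt_coeff_partial_sum_nonneg[of m] by (simp add: Suc lessThan_Suc_atMost)
  qed simp
qed simp

text \<open>
  The value \<open>sqrt (1 - t)\<close> at \<open>t = 1\<close>, obtained from the convolution identity: the square of the sum is
  \<open>1 - 1\<close>.
\<close>

lemma suminf_sqrt_coeff: "(\<Sum>n. sqrt_coeff n) = 0"
proof -
  have "(\<lambda>n. \<Sum>i\<le>n. sqrt_coeff i * sqrt_coeff (n - i)) sums ((\<Sum>n. sqrt_coeff n) * (\<Sum>n. sqrt_coeff n))"
    by (rule Cauchy_product_sums) (simp_all add: summable_sqrt_coeff)
  moreover have "(\<lambda>n. \<Sum>i\<le>n. sqrt_coeff i * sqrt_coeff (n - i)) sums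
      (\<Sum>n\<in>{0, 1}. \<Sum>i\<le>n. sqrt_coeff i * sqrt_coeff (n - i))"
    by (rule sums_finite) (auto simp: sqrt_coeff_convolution)
  ultimately have "(\<Sum>n. sqrt_coeff n) * (\<Sum>n. sqrt_coeff n)
      = (\<Sum>n\<in>{0, 1::nat}. if n = 0 then 1 else if n = 1 then - 1 else 0)"
    unfolding sqrt_coeff_convolution by (rule sums_unique2)
  then show ?thesis by simp
qed

lemma star_one [simp]: "(1::'a::unital_cstar_algebra)\<^sup>\<star> = 1"
  using star_mult[of "1\<^sup>\<star>" "1::'a"] by (simp add: star_star)

lemma star_power: "((x::'a::unital_cstar_algebra) ^ n)\<^sup>\<star> = (x\<^sup>\<star>) ^ n"
  by (induction n) (simp_all add: star_mult power_commutes)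

text \<open>
  The binomial series for \<open>sqrt (1 - g)\<close>. That \<open>1 - z\<close> stays in the unit ball holds since the absolute
  values of the coefficients of positive degree add up to 1, as all coefficients add up to 0.
\<close>

lemma positive_sqrt:
  fixes g :: "'a::unital_cstar_algebra"
  assumes sa: "g\<^sup>\<star> = g" and g: "norm g \<le> 1"
  obtains z where "z\<^sup>\<star> = z" "z * z = 1 - g" "norm (1 - z) \<le> 1"
    "\<And>x. x * g = g * x \<Longrightarrow> x * z = z * x"
proof -
  define s where "s n = sqrt_coeff n *\<^sub>R g ^ n" for n
  have le: "norm (s n) \<le> \<bar>sqrt_coeff n\<bar>" for n
  proof -
    have "norm (g ^ n) \<le> 1"
      using norm_power_ineq[of g n] power_le_one[OF norm_ge_zero g, of n] by linarith
    then show ?thesis by (simp add: s_def mult_left_le)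
  qed
  have sn: "summable (\<lambda>n. norm (s n))"
    by (rule summable_comparison_test'[OF summable_sqrt_coeff]) (simp add: le)
  then have ss: "summable s" by (rule summable_norm_cancel)
  define z where "z = (\<Sum>n. s n)"
  have "z\<^sup>\<star> = (\<Sum>n. (s n)\<^sup>\<star>)"
    unfolding z_def by (rule bounded_linear.suminf[OF bounded_linear_star ss])
  then have star: "z\<^sup>\<star> = z"
    by (simp add: s_def z_def star_scaleR star_power sa)
  have prod: "(\<lambda>n. \<Sum>i\<le>n. s i * s (n - i)) sums (z * z)"
    unfolding z_def by (rule Cauchy_product_sums[OF sn sn])
  have conv: "(\<Sum>i\<le>n. s i * s (n - i))
      = (if n = 0 then 1 else if n = 1 then - 1 else 0) *\<^sub>R g ^ n" for n
    unfolding sqrt_coeff_convolution[symmetric] scaleR_sum_left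
    by (rule sum.cong) (simp_all add: s_def power_add[symmetric])
  have "(\<lambda>n. \<Sum>i\<le>n. s i * s (n - i)) sums (\<Sum>n\<in>{0, 1}. \<Sum>i\<le>n. s i * s (n - i))"
    by (rule sums_finite) (auto simp: conv)
  with prod have "z * z = (\<Sum>n\<in>{0, 1}. \<Sum>i\<le>n. s i * s (n - i))"
    by (rule sums_unique2)
  also have "\<dots> = 1 - g" unfolding conv by simp
  finally have sq: "z * z = 1 - g" .
  have sc: "summable sqrt_coeff"
    using summable_sqrt_coeff summable_norm_cancel[of sqrt_coeff] by simp
  have s0: "s 0 = 1" by (simp add: s_def sqrt_coeff_0)
  have "1 - z = - (\<Sum>n. s (Suc n))"
    using suminf_split_head[OF ss] by (simp add: z_def s0)
  also have "norm \<dots> \<le> (\<Sum>n. norm (s (Suc n)))"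
    by (simp add: summable_norm[OF summable_Suc_iff[THEN iffD2, OF sn]])
  also have "\<dots> \<le> (\<Sum>n. - sqrt_coeff (Suc n))"
  proof (rule suminf_le)
    show "norm (s (Suc n)) \<le> - sqrt_coeff (Suc n)" for n
      using le[of "Suc n"] sqrt_coeff_nonpos[of "Suc n"] by simp
    show "summable (\<lambda>n. norm (s (Suc n)))" by (rule summable_Suc_iff[THEN iffD2, OF sn])
    show "summable (\<lambda>n. - sqrt_coeff (Suc n))"
      by (rule summable_minus[OF summable_Suc_iff[THEN iffD2, OF sc]])
  qed
  also have "\<dots> = 1"
    using suminf_split_head[OF sc] suminf_minus[OF summable_Suc_iff[THEN iffD2, OF sc]]
    by (simp add: suminf_sqrt_coeff sqrt_coeff_0)
  finally have "norm (1 - z) \<le> 1" .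
  moreover have "x * z = z * x" if "x * g = g * x" for x
  proof -
    have "x * g ^ n = g ^ n * x" for n
      by (rule power_commuting_commutes[symmetric]) (simp add: that)
    then have "x * s n = s n * x" for n by (simp add: s_def)
    then show ?thesis
      unfolding z_def suminf_mult[OF ss, symmetric] suminf_mult2[OF ss] by simp
  qed
  ultimately show ?thesis using that star sq by blast
qed

lemma norm_mult_self:
  fixes h :: "'a::cstar_algebra"
  assumes "h\<^sup>\<star> = h"
  shows "norm (h * h) = (norm h)\<^sup>2"
  using cstar_identity[of h] assms by simp

text \<open>
  With \<open>v = sqrt (1 - h\<^sup>2)\<close> the element \<open>u = h + \<i> v\<close> is unitary (cosine plus \<open>\<i>\<close> times sine), so its imaginary part \<open>v\<close>
  has norm at most 1, and \<open>1 - h\<^sup>2 = v\<^sup>2\<close>. This is the form in which the reality of the spectrum of \<open>h\<close> enters.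
\<close>

lemma norm_one_minus_square:
  fixes h :: "'a::unital_cstar_algebra"
  assumes sa: "h\<^sup>\<star> = h" and h: "norm h \<le> 1"
  shows "norm (1 - h * h) \<le> 1"
proof -
  have "norm (h * h) \<le> 1" using h by (simp add: norm_mult_self sa power_le_one)
  then obtain v where v: "v\<^sup>\<star> = v" "v * v = 1 - h * h"
    and comm: "\<And>x. x * (h * h) = h * h * x \<Longrightarrow> x * v = v * x"
    using positive_sqrt[of "h * h"] by (metis sa star_mult)
  have hv: "h * v = v * h" using comm[of h] by (simp add: mult.assoc)
  define u where "u = h + \<i> *\<^sub>C v"
  have us: "u\<^sup>\<star> = h - \<i> *\<^sub>C v"
    by (simp add: u_def star_simps sa v scaleC_simps)
  have "u\<^sup>\<star> * u = h * h + v * v"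
    unfolding us unfolding u_def
    by (simp add: algebra_simps mult_scaleC_left mult_scaleC_right scaleC_simps hv)
  then have "norm (u\<^sup>\<star> * u) = 1" by (simp add: v)
  then have "(norm u)\<^sup>2 = 1" by (simp add: cstar_identity)
  then have "norm u = 1" using norm_ge_zero[of u] by (auto simp: power2_eq_1_iff)
  then have nus: "norm (u\<^sup>\<star>) = 1" by (simp add: norm_star)
  have "u - u\<^sup>\<star> = (2 * \<i>) *\<^sub>C v"
    unfolding us unfolding u_def using scaleC_add_left[of \<i> \<i> v] by simp
  then have "2 * norm v = norm (u - u\<^sup>\<star>)" by (simp add: norm_scaleC norm_mult)
  also have "\<dots> \<le> 2"
    using norm_triangle_ineq4[of u "u\<^sup>\<star>"] \<open>norm u = 1\<close> nus by simp
  finally have "norm v \<le> 1" by simp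
  then show ?thesis by (simp add: v(2)[symmetric] norm_mult_self v(1) power_le_one)
qed

text \<open>
  A substitute for the spectral radius formula: by the C*-identity \<open>\<parallel>m\<parallel>\<close> to the power \<open>2 ^ k\<close> is the norm
  of \<open>m\<close> to the power \<open>2 ^ k\<close>, and an exponential cannot be dominated by a linear function.
\<close>

lemma norm_le_1_if_linear_growth:
  fixes m :: "'a::unital_cstar_algebra"
  assumes sa: "m\<^sup>\<star> = m" and growth: "\<And>n. norm (m ^ n) \<le> 1 + c * real n"
  shows "norm m \<le> 1"
proof (rule ccontr)
  assume "\<not> norm m \<le> 1"
  then have gt: "1 < norm m" by simp
  have pow: "norm (m ^ (2 ^ k)) = norm m ^ (2 ^ k)" for k
  proof (induction k)
    case (Suc k)
    have "(m ^ (2 ^ k))\<^sup>\<star> = m ^ (2 ^ k)" by (simp add: star_power sa)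
    from norm_mult_self[OF this] have "norm (m ^ (2 ^ k * 2)) = (norm (m ^ (2 ^ k)))\<^sup>2"
      by (simp add: power2_eq_square mult_2_right power_add)
    then show ?case by (simp add: Suc power_mult mult.commute[of 2])
  qed simp
  have "(\<lambda>n. inverse (norm m) ^ n + c * (real n * inverse (norm m) ^ n)) \<longlonglongrightarrow> 0 + c * 0"
    using gt
    by (intro tendsto_intros LIMSEQ_power_zero powser_times_n_limit_0) (simp_all add: inverse_less_1_iff)
  then have "(\<lambda>n. (1 + c * real n) / norm m ^ n) \<longlonglongrightarrow> 0"
    by (simp add: field_simps add_divide_distrib)
  then have "\<forall>\<^sub>F n in sequentially. (1 + c * real n) / norm m ^ n < 1"
    by (rule order_tendstoD) simp
  then obtain N where N: "\<And>n. N \<le> n \<Longrightarrow> (1 + c * real n) / norm m ^ n < 1"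
    by (auto simp: eventually_sequentially)
  have "N \<le> 2 ^ N" by simp
  moreover have "0 < norm m ^ (2 ^ N)"
    using gt by (intro zero_less_power) linarith
  ultimately have "1 + c * real (2 ^ N) < norm m ^ (2 ^ N)"
    using N[of "2 ^ N"] by (simp only: divide_less_eq_1_pos)
  then show False using growth[of "2 ^ N"] pow[of N] by simp
qed

section \<open>Positive elements\<close>

text \<open>
  Positivity is expressed by squares of self-adjoint elements rather than by products \<open>x\<^sup>\<star> x\<close>, because for squares
  the norm characterization in \<open>positive_elemI\<close> and \<open>positive_norm_bound\<close> follows from the binomial series.
\<close>

definition positive_elem :: "'a::cstar_algebra \<Rightarrow> bool"
  where "positive_elem p \<longleftrightarrow> (\<exists>z. z\<^sup>\<star> = z \<and> p = z * z)"

lemma positive_imp_selfadjoint: "positive_elem p \<Longrightarrow> p\<^sup>\<star> = p"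
  by (auto simp: positive_elem_def star_mult)

lemma positive_scaleR:
  assumes "positive_elem p" "0 \<le> r"
  shows "positive_elem (r *\<^sub>R p)"
proof -
  obtain z where z: "z\<^sup>\<star> = z" "p = z * z" using assms by (auto simp: positive_elem_def)
  have "(sqrt r *\<^sub>R z)\<^sup>\<star> = sqrt r *\<^sub>R z" "r *\<^sub>R p = (sqrt r *\<^sub>R z) * (sqrt r *\<^sub>R z)"
    using assms(2) by (simp_all add: z star_scaleR)
  then show ?thesis unfolding positive_elem_def by blast
qed

text \<open>
  The norm condition says that \<open>p / t\<close> is at distance at most 1 from the unit, so the binomial series provides
  a root. With its converse \<open>positive_norm_bound\<close> it shows that positivity is preserved by sums.
\<close>

lemma positive_elemI:
  fixes p :: "'a::unital_cstar_algebra"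
  assumes sa: "p\<^sup>\<star> = p" and t: "norm (t *\<^sub>R 1 - p) \<le> t"
  shows "positive_elem p"
proof (cases "t = 0")
  case True
  then have "p = 0 * 0" using t by simp
  then show ?thesis unfolding positive_elem_def using star_zero by blast
next
  case False
  then have pos: "0 < t" using t norm_ge_zero[of "t *\<^sub>R 1 - p"] by linarith
  have g: "(1 - inverse t *\<^sub>R p)\<^sup>\<star> = 1 - inverse t *\<^sub>R p" by (simp add: star_simps sa)
  have "1 - inverse t *\<^sub>R p = inverse t *\<^sub>R (t *\<^sub>R 1 - p)"
    using pos by (simp add: scaleR_diff_right)
  then have "norm (1 - inverse t *\<^sub>R p) = inverse t * norm (t *\<^sub>R 1 - p)"
    using pos by simp
  also have "\<dots> \<le> 1"
    using mult_left_mono[OF t, of "inverse t"] pos by simp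
  finally have "norm (1 - inverse t *\<^sub>R p) \<le> 1" .
  then obtain z where "z\<^sup>\<star> = z" "z * z = 1 - (1 - inverse t *\<^sub>R p)"
    using positive_sqrt[OF g] by metis
  then have "positive_elem (inverse t *\<^sub>R p)" unfolding positive_elem_def by (metis diff_diff_eq2 add_diff_cancel_left')
  from positive_scaleR[OF this, of t] show ?thesis using pos by simp
qed

lemma positive_norm_bound:
  fixes p :: "'a::unital_cstar_algebra"
  assumes "positive_elem p"
  shows "norm (norm p *\<^sub>R 1 - p) \<le> norm p"
proof -
  obtain z where z: "z\<^sup>\<star> = z" "p = z * z" using assms by (auto simp: positive_elem_def)
  have np: "norm p = norm z * norm z" by (simp add: z norm_mult_self power2_eq_square)
  show ?thesis
  proof (cases "norm z = 0")
    case False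
    let ?h = "inverse (norm z) *\<^sub>R z"
    have "norm (1 - ?h * ?h) \<le> 1"
      by (rule norm_one_minus_square) (use False in \<open>simp_all add: star_scaleR z\<close>)
    then have "norm p * norm (1 - ?h * ?h) \<le> norm p" by (simp add: mult_left_le)
    moreover have "norm p *\<^sub>R 1 - p = norm p *\<^sub>R (1 - ?h * ?h)"
      using False by (simp add: np scaleR_diff_right z(2)[symmetric] field_simps)
    ultimately show ?thesis by simp
  qed (use z in simp)
qed

lemma positive_suminf:
  fixes p :: "nat \<Rightarrow> 'a::unital_cstar_algebra"
  assumes pos: "\<And>n. positive_elem (p n)" and sn: "summable (\<lambda>n. norm (p n))"
  shows "positive_elem (\<Sum>n. p n)"
proof (rule positive_elemI)
  have s: "summable p" using sn by (rule summable_norm_cancel)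
  show "(\<Sum>n. p n)\<^sup>\<star> = (\<Sum>n. p n)"
    using bounded_linear.suminf[OF bounded_linear_star s]
    by (simp add: positive_imp_selfadjoint[OF pos])
  have "(\<Sum>n. norm (p n)) *\<^sub>R 1 - (\<Sum>n. p n) = (\<Sum>n. norm (p n) *\<^sub>R 1 - p n)"
    by (simp add: suminf_diff[OF _ s] bounded_linear.suminf[OF bounded_linear_scaleR_left sn]
        bounded_linear.summable[OF bounded_linear_scaleR_left sn])
  also have "norm \<dots> \<le> (\<Sum>n. norm (p n))"
    by (rule norm_suminf_le) (auto intro: positive_norm_bound pos sn)
  finally show "norm ((\<Sum>n. norm (p n)) *\<^sub>R 1 - (\<Sum>n. p n)) \<le> (\<Sum>n. norm (p n))" .
qed

text \<open>
  Here \<open>z\<close> plays the role of \<open>\<bar>h\<bar>\<close> and \<open>y = (z + h) / 2\<close> that of the positive part of \<open>h\<close>. The latter satisfies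
  \<open>y\<^sup>2 = z y\<close>, hence \<open>(1 - y)\<^sup>n y = (1 - z)\<^sup>n y\<close> is bounded and the powers of \<open>1 - y\<close> grow at most linearly.
\<close>

lemma positive_half_abs_plus:
  fixes h z :: "'a::unital_cstar_algebra"
  assumes h: "h\<^sup>\<star> = h" and z: "z\<^sup>\<star> = z" "z * z = h * h" "norm (1 - z) \<le> 1"
    and comm: "h * z = z * h"
  shows "positive_elem ((1 / 2) *\<^sub>R (z + h))"
proof -
  define y where "y = (1 / 2) *\<^sub>R (z + h)"
  have ysa: "y\<^sup>\<star> = y" by (simp add: y_def star_simps h z)
  have zy: "z * y = y * z" by (simp add: y_def algebra_simps comm)
  have "y * y = (1 / 4) *\<^sub>R (2 *\<^sub>R (z * z + z * h))"
    by (simp add: y_def algebra_simps comm z(2) scaleR_2)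
  then have yy: "y * y = z * y" by (simp add: y_def algebra_simps)
  have y1: "(1 - y) * y = (1 - z) * y" by (simp add: algebra_simps yy)
  have shift: "(1 - y) ^ n * y = (1 - z) ^ n * y" for n
  proof (induction n)
    case (Suc n)
    have "(1 - y) ^ Suc n * y = (1 - y) * ((1 - z) ^ n * y)" by (simp add: mult.assoc Suc)
    also have "\<dots> = (1 - z) ^ n * ((1 - y) * y)"
    proof -
      have "(1 - y) * (1 - z) = (1 - z) * (1 - y)" by (simp add: algebra_simps zy)
      then have "(1 - y) * (1 - z) ^ n = (1 - z) ^ n * (1 - y)"
        by (rule power_commuting_commutes[symmetric, OF sym])
      then show ?thesis by (metis mult.assoc)
    qed
    also have "\<dots> = (1 - z) ^ Suc n * y" by (simp add: y1 mult.assoc[symmetric] power_commutes)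
    finally show ?case .
  qed simp
  have growth: "norm ((1 - y) ^ n) \<le> 1 + norm y * real n" for n
  proof (induction n)
    case (Suc n)
    have "(1 - y) ^ Suc n = (1 - y) ^ n - (1 - z) ^ n * y"
      unfolding power_Suc2 shift[symmetric] by (simp add: right_diff_distrib)
    also have "norm \<dots> \<le> norm ((1 - y) ^ n) + norm ((1 - z) ^ n * y)"
      by (rule norm_triangle_ineq4)
    also have "norm ((1 - z) ^ n * y) \<le> 1 * norm y"
    proof (rule order_trans[OF norm_mult_ineq mult_right_mono])
      show "norm ((1 - z) ^ n) \<le> 1"
        using norm_power_ineq[of "1 - z" n] power_le_one[OF norm_ge_zero z(3), of n] by linarith
    qed simp
    finally show ?case using Suc by (simp add: algebra_simps)
  qed simp
  have "norm (1 - y) \<le> 1"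
    by (rule norm_le_1_if_linear_growth[OF _ growth]) (simp add: star_diff ysa)
  then have "positive_elem y" using positive_elemI[OF ysa, of 1] by simp
  then show ?thesis by (simp add: y_def)
qed

lemma character_simps:
  assumes "character chi"
  shows "chi (a + b) = chi a + chi b" "chi (c *\<^sub>C a) = c * chi a" "chi (a * b) = chi a * chi b"
    "chi 0 = 0" "chi (- a) = - chi a" "chi (a - b) = chi a - chi b" "chi (r *\<^sub>R a) = of_real r * chi a"
proof -
  show add: "chi (a + b) = chi a + chi b" and scale: "chi (c *\<^sub>C a) = c * chi a"
    and "chi (a * b) = chi a * chi b" for a b c
    using assms by (auto simp: character_def)
  show "chi 0 = 0" using add[of 0 0] by simp
  show minus: "chi (- a) = - chi a" for a
    using scale[of "-1" a] by (simp add: scaleC_minus_left)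
  show "chi (a - b) = chi a - chi b" using add[of a "-b"] minus[of b] by simp
  show "chi (r *\<^sub>R a) = of_real r * chi a" by (simp add: scaleR_scaleC scale)
qed

text \<open>
  The decomposition into positive and negative part, with \<open>\<bar>h\<bar>\<close> constructed as the root of \<open>h\<^sup>2\<close>. The last
  clause keeps both parts in every ideal that is the kernel of a character and contains \<open>h\<close>.
\<close>

lemma selfadjoint_diff_positive:
  fixes h :: "'a::unital_cstar_algebra"
  assumes h: "h\<^sup>\<star> = h"
  obtains p q where "positive_elem p" "positive_elem q" "h = p - q" "norm p \<le> norm h" "norm q \<le> norm h"
    "\<And>chi. character chi \<Longrightarrow> chi h = 0 \<Longrightarrow> chi p = 0 \<and> chi q = 0"
proof (cases "norm h = 0")
  case True
  have "positive_elem (0::'a)" by (rule positive_elemI[of _ 0]) simp_all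
  then show ?thesis using that[of 0 0] True by (simp add: character_simps)
next
  case False
  define n where "n = norm h"
  define k where "k = inverse n *\<^sub>R h"
  have n: "0 < n" using False by (simp add: n_def)
  have k: "k\<^sup>\<star> = k" "norm k = 1" using n by (simp_all add: k_def star_scaleR h n_def)
  have "norm (1 - k * k) \<le> 1" by (rule norm_one_minus_square) (simp_all add: k)
  moreover have "(1 - k * k)\<^sup>\<star> = 1 - k * k" by (simp add: star_simps k)
  ultimately obtain z where z: "z\<^sup>\<star> = z" "z * z = 1 - (1 - k * k)" "norm (1 - z) \<le> 1"
    and c: "\<And>x. x * (1 - k * k) = (1 - k * k) * x \<Longrightarrow> x * z = z * x"
    using positive_sqrt by blast
  have zz: "z * z = k * k" using z(2) by simp
  have kz: "k * z = z * k" by (rule c) (simp add: algebra_simps)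
  have "norm (z * z) = norm (k * k)" by (simp add: zz)
  then have "(norm z)\<^sup>2 = 1" by (simp add: norm_mult_self z(1) k)
  then have nz: "norm z = 1" using norm_ge_zero[of z] by (auto simp: power2_eq_1_iff)
  define p where "p = n *\<^sub>R (1 / 2) *\<^sub>R (z + k)"
  define q where "q = n *\<^sub>R (1 / 2) *\<^sub>R (z + - k)"
  have pos: "positive_elem p" "positive_elem q"
    unfolding p_def q_def
    by (rule positive_scaleR[OF positive_half_abs_plus]; use n z(1,3) zz kz k(1) in \<open>simp add: star_minus\<close>)+
  have "p - q = n *\<^sub>R k"
    by (simp add: p_def q_def algebra_simps flip: scaleR_add_left)
  then have "h = p - q" using n by (simp add: k_def)
  moreover have "norm p \<le> norm h" "norm q \<le> norm h"
    using norm_triangle_ineq[of z k] norm_triangle_ineq4[of z k] n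
    by (simp_all add: p_def q_def nz k(2) n_def)
  moreover have "chi p = 0 \<and> chi q = 0" if "character chi" "chi h = 0" for chi
  proof -
    note ch = character_simps[OF that(1)]
    have "chi k = 0" by (simp add: k_def ch that(2))
    then have "chi z * chi z = 0" by (simp add: ch(3)[symmetric] zz) (simp add: ch)
    then show ?thesis by (simp add: p_def q_def ch \<open>chi k = 0\<close>)
  qed
  ultimately show ?thesis using that pos by blast
qed

section \<open>Resolvents and characters\<close>

lemma neumann_inverse:
  fixes w :: "'a::unital_cstar_algebra"
  assumes "norm w < 1"
  obtains S where "S * (1 - w) = 1" "\<And>x. x * w = w * x \<Longrightarrow> x * S = S * x"
    "w\<^sup>\<star> = w \<Longrightarrow> S\<^sup>\<star> = S"
proof
  let ?S = "\<Sum>n. w ^ n"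
  have s: "summable (\<lambda>n. w ^ n)" using assms by (rule complete_algebra_summable_geometric)
  have "?S * w = (\<Sum>n. w ^ Suc n)"
    unfolding suminf_mult2[OF s] by (simp add: power_commutes)
  also have "\<dots> = ?S - 1" using suminf_split_head[OF s] by simp
  finally show "?S * (1 - w) = 1" by (simp add: algebra_simps)
  show "x * ?S = ?S * x" if "x * w = w * x" for x
    unfolding suminf_mult[OF s, symmetric] suminf_mult2[OF s]
    using power_commuting_commutes[of w x] that by simp
  show "?S\<^sup>\<star> = ?S" if "w\<^sup>\<star> = w"
    using bounded_linear.suminf[OF bounded_linear_star s] by (simp add: star_power that)
qed

text \<open>
  \<open>R = (1 + l m\<^sup>2)\<^sup>-\<^sup>1\<close> comes from a Neumann series around \<open>1 + t\<close>, where \<open>t = \<parallel>l m\<^sup>2\<parallel>\<close>, since \<open>l m\<^sup>2\<close> is positive.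
  The last estimate makes \<open>1 - R\<close> an approximate unit for \<open>m\<close> as \<open>l\<close> grows; it follows from
  \<open>l R m\<^sup>2 R = (1 - R) R\<close>.
\<close>

lemma resolvent_of_square:
  fixes m :: "'a::unital_cstar_algebra"
  assumes m: "m\<^sup>\<star> = m" and l: "0 < l"
  obtains R where "R\<^sup>\<star> = R" "R * (1 + l *\<^sub>R (m * m)) = 1" "norm R \<le> 1" "m * R = R * m"
    "(norm (m * R))\<^sup>2 \<le> 2 / l"
proof -
  define s where "s = l *\<^sub>R (m * m)"
  have ps: "positive_elem s"
    unfolding s_def by (rule positive_scaleR) (use m l in \<open>auto simp: positive_elem_def\<close>)
  define t where "t = norm s"
  have t: "0 \<le> t" by (simp add: t_def)
  define w where "w = inverse (1 + t) *\<^sub>R (t *\<^sub>R 1 - s)"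
  have "norm (t *\<^sub>R 1 - s) \<le> t" unfolding t_def by (rule positive_norm_bound[OF ps])
  from mult_left_mono[OF this, of "inverse (1 + t)"] have nw: "norm w \<le> t / (1 + t)"
    unfolding w_def norm_scaleR using t by (simp add: divide_inverse mult.commute)
  also have "\<dots> < 1" using t by simp
  finally have "norm w < 1" .
  then obtain S where S: "S * (1 - w) = 1" "\<And>x. x * w = w * x \<Longrightarrow> x * S = S * x"
    "w\<^sup>\<star> = w \<Longrightarrow> S\<^sup>\<star> = S" using neumann_inverse by blast
  have w1: "(1 + t) *\<^sub>R (1 - w) = 1 + s"
  proof -
    have "(1 + t) *\<^sub>R w = t *\<^sub>R 1 - s" using t by (simp add: w_def)
    then show ?thesis by (simp add: scaleR_diff_right scaleR_add_left)
  qed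
  define R where "R = inverse (1 + t) *\<^sub>R S"
  have "R * (1 + s) = S * (1 - w)"
    unfolding w1[symmetric] R_def using t by simp
  then have inv: "R * (1 + s) = 1" by (simp add: S)
  have wsa: "w\<^sup>\<star> = w" by (simp add: w_def star_simps positive_imp_selfadjoint[OF ps])
  then have Rsa: "R\<^sup>\<star> = R" by (simp add: R_def star_scaleR S)
  have "m * w = w * m" by (simp add: w_def s_def algebra_simps)
  then have mR: "m * R = R * m" by (simp add: R_def S(2))
  have "R = inverse (1 + t) *\<^sub>R 1 + R * w"
    using S(1) by (simp add: R_def algebra_simps flip: scaleR_add_right scaleR_diff_right)
  then have "norm R \<le> norm (inverse (1 + t) *\<^sub>R (1::'a)) + norm (R * w)"
    by (metis norm_triangle_ineq)
  also have "\<dots> \<le> inverse (1 + t) + norm R * (t / (1 + t))"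
    using t order_trans[OF norm_mult_ineq[of R w] mult_left_mono[OF nw norm_ge_zero[of R]]] by simp
  finally have "norm R * (1 + t) \<le> (inverse (1 + t) + norm R * (t / (1 + t))) * (1 + t)"
    using t by (intro mult_right_mono) simp_all
  also have "\<dots> = 1 + norm R * t" using t by (simp add: field_simps)
  finally have nR: "norm R \<le> 1" by (simp add: algebra_simps)
  have sR: "R * s = 1 - R" using inv by (simp add: algebra_simps)
  have "(norm (m * R))\<^sup>2 = norm (R * (m * m) * R)"
    by (simp add: cstar_identity[symmetric] star_mult m Rsa mult.assoc)
  then have "l * (norm (m * R))\<^sup>2 = norm (R * s * R)"
    using l by (simp add: s_def)
  also have "\<dots> = norm ((1 - R) * R)" by (simp add: sR)
  also have "\<dots> \<le> 2 * 1"
    by (rule order_trans[OF norm_mult_ineq mult_mono])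
      (use nR norm_triangle_ineq4[of 1 R] in simp_all)
  finally have "(norm (m * R))\<^sup>2 \<le> 2 / l" using l by (simp add: field_simps)
  then show ?thesis using that Rsa inv nR mR by (simp add: s_def)
qed

lemma character_one:
  fixes chi :: "'a::unital_cstar_algebra \<Rightarrow> complex"
  assumes "character chi"
  shows "chi 1 = 1"
proof -
  obtain a where "chi a \<noteq> 0" using assms by (auto simp: character_def)
  then show ?thesis using character_simps(3)[OF assms, of 1 a] by simp
qed

text \<open>
  If \<open>\<parallel>a\<parallel> < \<bar>chi a\<bar>\<close>, then \<open>1 - a / chi a\<close> would be invertible and in the kernel of the character.
\<close>

lemma character_contractive:
  fixes chi :: "'a::unital_cstar_algebra \<Rightarrow> complex"
  assumes "character chi"
  shows "cmod (chi a) \<le> norm a"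
proof (rule ccontr)
  note ch = character_simps[OF assms]
  assume "\<not> cmod (chi a) \<le> norm a"
  then have lt: "norm a < cmod (chi a)" by simp
  then have "chi a \<noteq> 0" using norm_ge_zero[of a] by force
  have "norm (inverse (chi a) *\<^sub>C a) < 1"
    using lt \<open>chi a \<noteq> 0\<close> by (simp add: norm_scaleC norm_inverse norm_divide field_simps)
  then obtain S where "S * (1 - inverse (chi a) *\<^sub>C a) = 1" using neumann_inverse by blast
  then have "chi S * chi (1 - inverse (chi a) *\<^sub>C a) = 1" using ch(3) character_one[OF assms] by metis
  then show False using \<open>chi a \<noteq> 0\<close> by (simp add: ch character_one[OF assms])
qed

text \<open>
  Arens' argument: a self-adjoint \<open>h\<close> satisfies \<open>\<parallel>h + \<i> t\<parallel>\<^sup>2 \<le> \<parallel>h\<parallel>\<^sup>2 + t\<^sup>2\<close> for all real \<open>t\<close>, which is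
  incompatible with a nonzero imaginary part of \<open>chi h\<close> once \<open>t\<close> is large and of the right sign.
\<close>

lemma character_star:
  fixes chi :: "'a::unital_cstar_algebra \<Rightarrow> complex"
  assumes "character chi"
  shows "chi (a\<^sup>\<star>) = cnj (chi a)"
proof -
  note ch = character_simps[OF assms] character_one[OF assms]
  have real: "Im (chi h) = 0" if h: "h\<^sup>\<star> = h" for h
  proof (rule ccontr)
    assume ne: "Im (chi h) \<noteq> 0"
    define b where "b = Im (chi h)"
    define t where "t = (norm h)\<^sup>2 / b"
    let ?k = "h + (\<i> * of_real t) *\<^sub>C 1"
    have "?k\<^sup>\<star> * ?k = h * h + (t * t) *\<^sub>R 1"
      by (simp add: star_simps h algebra_simps mult_scaleC_left mult_scaleC_right scaleC_simps
          scaleR_scaleC)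
    then have "(norm ?k)\<^sup>2 = norm (h * h + (t * t) *\<^sub>R 1)"
      using cstar_identity[of ?k] by simp
    also have "\<dots> \<le> (norm h)\<^sup>2 + t * t"
      using norm_triangle_ineq[of "h * h" "(t * t) *\<^sub>R 1"] by (simp add: norm_mult_self h)
    finally have "(norm ?k)\<^sup>2 \<le> (norm h)\<^sup>2 + t * t" .
    moreover have "(cmod (chi ?k))\<^sup>2 \<le> (norm ?k)\<^sup>2"
      by (rule power_mono[OF character_contractive[OF assms]]) simp
    moreover have "(cmod (chi ?k))\<^sup>2 = (Re (chi h))\<^sup>2 + (b + t)\<^sup>2"
      by (simp add: cmod_power2 ch b_def)
    ultimately have "(b + t)\<^sup>2 \<le> (norm h)\<^sup>2 + t * t"
      using zero_le_power2[of "Re (chi h)"] by linarith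
    then have "b * b + 2 * (b * t) \<le> (norm h)\<^sup>2" by (simp add: power2_eq_square algebra_simps)
    moreover have "b * t = (norm h)\<^sup>2" using ne by (simp add: t_def b_def)
    moreover have "0 < b * b" using ne by (simp add: b_def not_real_square_gt_zero zero_less_mult_iff) linarith
    ultimately show False using zero_le_power2[of "norm h"] by linarith
  qed
  have "Im (chi (a + a\<^sup>\<star>)) = 0" by (rule real) (simp add: star_simps add.commute)
  moreover have "Im (chi (\<i> *\<^sub>C (a - a\<^sup>\<star>))) = 0"
    by (rule real) (simp add: star_simps scaleC_simps)
  ultimately show ?thesis by (simp add: complex_eq_iff ch)
qed

section \<open>A Riesz argument on the range of a linear map\<close>

lemma cinner_add_left: "cinner (x + y) z = cinner x z + cinner y (z::'a::complex_inner)"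
  using cinner_commute[of "x + y" z] cinner_commute[of x z] cinner_commute[of y z]
  by (simp add: cinner_add_right)

lemma cinner_scaleC_left: "cinner (c *\<^sub>C x) y = cnj c * cinner x (y::'a::complex_inner)"
  using cinner_commute[of "c *\<^sub>C x" y] cinner_commute[of x y]
  by (simp add: cinner_scaleC_right)

lemma cinner_zero [simp]: "cinner 0 x = 0" "cinner x (0::'a::complex_inner) = 0"
  using cinner_scaleC_left[of 0 0 x] cinner_scaleC_right[of x 0 0] by simp_all

lemma cinner_diff_right: "cinner x (y - z) = cinner x y - cinner x (z::'a::complex_inner)"
  using cinner_add_right[of x y "- z"] cinner_scaleC_right[of x "-1" z]
  by (simp add: scaleC_minus_left)

lemma cinner_diff_left: "cinner (x - y) z = cinner x z - cinner y (z::'a::complex_inner)"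
  using cinner_add_left[of x "- y" z] cinner_scaleC_left[of "-1" y z]
  by (simp add: scaleC_minus_left)

lemmas cinner_simps = cinner_add_left cinner_add_right cinner_diff_left cinner_diff_right
  cinner_scaleC_left cinner_scaleC_right

lemma norm_scaleC_inner: "norm (c *\<^sub>C x) = cmod c * norm (x::'a::complex_inner)"
proof -
  have "complex_of_real ((norm (c *\<^sub>C x))\<^sup>2) = cnj c * c * cinner x x"
    unfolding cinner_self by (simp add: cinner_simps)
  also have "\<dots> = complex_of_real ((cmod c * norm x)\<^sup>2)"
    unfolding cinner_self[symmetric] power_mult_distrib
    by (simp add: complex_norm_square[symmetric] mult.commute[of "cnj c"] del: of_real_power)
  finally have "(norm (c *\<^sub>C x))\<^sup>2 = (cmod c * norm x)\<^sup>2" by (simp only: of_real_eq_iff)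
  then show ?thesis by simp
qed

lemma bounded_linear_scaleC_inner: "bounded_linear (\<lambda>x::'a::complex_inner. c *\<^sub>C x)"
  by (rule bounded_linear_intro[where K = "cmod c"])
    (simp_all add: scaleC_simps scaleR_scaleC norm_scaleC_inner mult.commute)

text \<open>
  The representing vector is the limit of \<open>D v\<close> along a minimizing sequence of \<open>\<parallel>D v\<parallel>\<^sup>2 - 2 g v\<close>.
  Minimizing over \<open>v\<close> rather than over the Hilbert space accommodates a \<open>g\<close> that is not given as a function of \<open>D v\<close>
  and places the vector in the closure of the range.
\<close>

lemma riesz_on_range:
  fixes D :: "'v::real_vector \<Rightarrow> 'h::{real_inner, complete_space}" and g :: "'v \<Rightarrow> real"
  assumes D: "linear D" and g: "linear g"
    and lower: "\<And>v. - B \<le> (norm (D v))\<^sup>2 - 2 * g v"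
  obtains \<xi> where "\<xi> \<in> closure (range D)" "\<And>v. g v = inner \<xi> (D v)"
proof -
  note lin = linear_add[OF D] linear_scale[OF D] linear_add[OF g] linear_scale[OF g]
  define J where "J v = (norm (D v))\<^sup>2 - 2 * g v" for v
  have bdd: "bdd_below (range J)" using lower by (auto simp: J_def intro!: bdd_belowI)
  define d where "d = Inf (range J)"
  have d_le: "d \<le> J v" for v unfolding d_def by (rule cInf_lower[OF _ bdd]) simp
  have "\<exists>v. J v < d + inverse (real (Suc n))" for n
  proof -
    have "\<exists>y\<in>range J. y < d + inverse (real (Suc n))"
      unfolding d_def by (rule cInf_lessD) auto
    then show ?thesis by blast
  qed
  then obtain X where X: "\<And>n. J (X n) < d + inverse (real (Suc n))" by metis
  have par: "(norm (D v - D w))\<^sup>2 = 2 * J v + 2 * J w - 4 * J ((1/2) *\<^sub>R (v + w))" for v w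
    by (simp add: J_def power2_norm_eq_inner lin inner_simps inner_commute algebra_simps)
  have close: "(norm (D (X m) - D (X n)))\<^sup>2 \<le> 4 * inverse (real (Suc N))"
    if "N \<le> m" "N \<le> n" for m n N
  proof -
    have "inverse (real (Suc m)) \<le> inverse (real (Suc N))"
      "inverse (real (Suc n)) \<le> inverse (real (Suc N))"
      using that by (simp_all add: le_imp_inverse_le)
    then show ?thesis
      using par[of "X m" "X n"] X[of m] X[of n] d_le[of "(1/2) *\<^sub>R (X m + X n)"] by linarith
  qed
  have "Cauchy (\<lambda>n. D (X n))"
  proof (rule CauchyI)
    fix e :: real assume e: "0 < e"
    then obtain N where "inverse (real (Suc N)) < e\<^sup>2 / 4"
      using reals_Archimedean[of "e\<^sup>2 / 4"] by auto
    then have "(norm (D (X m) - D (X n)))\<^sup>2 < e\<^sup>2" if "N \<le> m" "N \<le> n" for m n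
      using close[OF that] by linarith
    then show "\<exists>N. \<forall>m\<ge>N. \<forall>n\<ge>N. norm (D (X m) - D (X n)) < e"
      using e power_less_imp_less_base[of _ 2 e] by (metis less_imp_le)
  qed
  then obtain \<xi> where \<xi>: "(\<lambda>n. D (X n)) \<longlonglongrightarrow> \<xi>" using Cauchy_convergent convergentD by blast
  have cl: "\<xi> \<in> closure (range D)"
    unfolding closure_sequential by (intro exI[of _ "\<lambda>n. D (X n)"]) (simp add: \<xi>)
  have var: "0 \<le> 2 * t * (inner \<xi> (D v) - g v) + t\<^sup>2 * (norm (D v))\<^sup>2" for t v
  proof -
    have J: "J (X n + t *\<^sub>R v)
        = J (X n) + 2 * t * (inner (D (X n)) (D v) - g v) + t\<^sup>2 * (norm (D v))\<^sup>2" for n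
      by (simp add: J_def power2_norm_eq_inner lin inner_simps inner_commute algebra_simps
          power2_eq_square[of t])
    have "0 \<le> inverse (real (Suc n)) + 2 * t * (inner (D (X n)) (D v) - g v)
        + t\<^sup>2 * (norm (D v))\<^sup>2" for n
      using d_le[of "X n + t *\<^sub>R v"] X[of n] unfolding J by linarith
    moreover have "(\<lambda>n. inverse (real (Suc n)) + 2 * t * (inner (D (X n)) (D v) - g v)
        + t\<^sup>2 * (norm (D v))\<^sup>2) \<longlonglongrightarrow> 0 + 2 * t * (inner \<xi> (D v) - g v) + t\<^sup>2 * (norm (D v))\<^sup>2"
      by (intro tendsto_intros LIMSEQ_inverse_real_of_nat \<xi>)
    ultimately have "0 \<le> 0 + 2 * t * (inner \<xi> (D v) - g v) + t\<^sup>2 * (norm (D v))\<^sup>2"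
      by (intro LIMSEQ_le_const) auto
    then show ?thesis by simp
  qed
  have "g v = inner \<xi> (D v)" for v
  proof (rule ccontr)
    assume ne: "g v \<noteq> inner \<xi> (D v)"
    define s where "s = inner \<xi> (D v) - g v"
    define q where "q = (norm (D v))\<^sup>2 + 1"
    have q: "0 < q" unfolding q_def by (simp add: add_nonneg_pos)
    have "0 \<le> 2 * (- s / q) * s + (- s / q)\<^sup>2 * (norm (D v))\<^sup>2"
      using var[of "- s / q" v] by (simp add: s_def)
    also have "\<dots> \<le> 2 * (- s / q) * s + (- s / q)\<^sup>2 * q"
      by (simp add: q_def mult_left_mono)
    also have "\<dots> = - (s\<^sup>2 / q)" using q by (simp add: power2_eq_square field_simps)
    also have "\<dots> < 0" using q ne by (simp add: s_def)
    finally show False by simp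
  qed
  with cl that show ?thesis by blast
qed

section \<open>The implementing vector\<close>

text \<open>
  The components of a structure map that is compatible with adjoints and vanishes at the unit. The remaining
  corner, which maps \<open>\<eta>\<close> to \<open>\<langle>\<delta> (a\<^sup>\<star>), \<eta>\<rangle>\<close>, is determined by \<open>\<delta>\<close>.
\<close>

locale structure_components =
  fixes chi :: "'b::unital_cstar_algebra \<Rightarrow> complex"
    and \<pi> :: "'b \<Rightarrow> 'h::chilbert_space \<Rightarrow> 'h"
    and \<delta> :: "'b \<Rightarrow> 'h"
    and \<gamma> :: "'b \<Rightarrow> complex"
  assumes chi: "character chi"
    and \<pi>_bounded: "bounded_linear (\<pi> a)"
    and \<pi>_adjoint: "cinner (\<pi> a \<eta>) \<zeta> = cinner \<eta> (\<pi> (a\<^sup>\<star>) \<zeta>)"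
    and \<delta>_add: "\<delta> (a + b) = \<delta> a + \<delta> b"
    and \<delta>_scaleC: "\<delta> (c *\<^sub>C a) = c *\<^sub>C \<delta> a"
    and \<gamma>_add: "\<gamma> (a + b) = \<gamma> a + \<gamma> b"
    and \<gamma>_scaleC: "\<gamma> (c *\<^sub>C a) = c * \<gamma> a"
    and \<delta>_mult: "\<delta> (a * b) = \<pi> a (\<delta> b) + chi b *\<^sub>C \<delta> a"
    and \<gamma>_star_mult: "\<gamma> (a\<^sup>\<star> * b) = cnj (\<gamma> a) * chi b + cnj (chi a) * \<gamma> b + cinner (\<delta> a) (\<delta> b)"
    and \<delta>_one: "\<delta> 1 = 0"
    and \<gamma>_one: "\<gamma> 1 = 0"
begin

lemmas chi_simps = character_simps[OF chi] character_one[OF chi] character_star[OF chi]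

lemma \<gamma>_simps: "\<gamma> 0 = 0" "\<gamma> (a - b) = \<gamma> a - \<gamma> b" "\<gamma> (r *\<^sub>R a) = of_real r * \<gamma> a"
proof -
  show "\<gamma> 0 = 0" using \<gamma>_scaleC[of 0 0] by simp
  show "\<gamma> (a - b) = \<gamma> a - \<gamma> b"
    using \<gamma>_add[of a "- b"] \<gamma>_scaleC[of "-1" b] by (simp add: scaleC_minus_left)
  show "\<gamma> (r *\<^sub>R a) = of_real r * \<gamma> a" by (simp add: scaleR_scaleC \<gamma>_scaleC)
qed

lemma \<delta>_simps: "\<delta> 0 = 0" "\<delta> (a - b) = \<delta> a - \<delta> b"
proof -
  show "\<delta> 0 = 0" using \<delta>_scaleC[of 0 0] by simp
  show "\<delta> (a - b) = \<delta> a - \<delta> b"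
    using \<delta>_add[of a "- b"] \<delta>_scaleC[of "-1" b] by (simp add: scaleC_minus_left)
qed

lemma \<gamma>_star: "\<gamma> (a\<^sup>\<star>) = cnj (\<gamma> a)"
  using \<gamma>_star_mult[of a 1] by (simp add: chi_simps \<gamma>_one \<delta>_one)

lemma Re_\<gamma>_star_self:
  assumes "chi a = 0"
  shows "Re (\<gamma> (a\<^sup>\<star> * a)) = (norm (\<delta> a))\<^sup>2"
  by (simp add: \<gamma>_star_mult assms power2_norm_eq_inner inner_Re_cinner)

text \<open>
  Automatic continuity. If the bound failed, there would be positive elements \<open>q n\<close> of the kernel of
  norm \<open>2\<^sup>-\<^sup>n\<close> on which \<open>Re \<gamma>\<close> exceeds \<open>2\<^sup>n\<close>. Their sum \<open>w\<close> is in the kernel, and \<open>w - q n\<close> is again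
  positive, so \<open>Re (\<gamma> w)\<close> would exceed \<open>2\<^sup>n\<close> for every \<open>n\<close>.
\<close>

lemma positive_bounded:
  obtains C where "0 \<le> C"
    "\<And>p. positive_elem p \<Longrightarrow> chi p = 0 \<Longrightarrow> 0 \<le> Re (\<gamma> p) \<and> Re (\<gamma> p) \<le> C * norm p"
proof -
  have nonneg: "0 \<le> Re (\<gamma> p)" if p: "positive_elem p" "chi p = 0" for p
  proof -
    obtain z where z: "z\<^sup>\<star> = z" "p = z * z" using p by (auto simp: positive_elem_def)
    then have "chi z = 0" using p by (simp add: chi_simps)
    from Re_\<gamma>_star_self[OF this] show ?thesis by (simp add: z)
  qed
  have "\<exists>C. \<forall>p. positive_elem p \<and> chi p = 0 \<longrightarrow> Re (\<gamma> p) \<le> C * norm p"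
  proof (rule ccontr)
    assume "\<not> ?thesis"
    then have "\<forall>n::nat. \<exists>p. positive_elem p \<and> chi p = 0 \<and> 4 ^ n * norm p < Re (\<gamma> p)"
      by (meson not_le)
    then obtain p where p: "\<And>n. positive_elem (p n)" "\<And>n. chi (p n) = 0"
      "\<And>n. 4 ^ n * norm (p n) < Re (\<gamma> (p n))" by metis
    have np: "0 < norm (p n)" for n using p(3)[of n] by (auto simp: \<gamma>_simps)
    define q where "q n = (1 / (2 ^ n * norm (p n))) *\<^sub>R p n" for n
    have q: "positive_elem (q n)" "chi (q n) = 0" for n
      using p by (simp_all add: q_def positive_scaleR chi_simps)
    have nq: "norm (q n) = (1 / 2) ^ n" for n
      using np[of n] by (simp add: q_def power_divide)
    have big: "2 ^ n < Re (\<gamma> (q n))" for n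
    proof -
      have "2 ^ n * (2 ^ n * norm (p n)) < Re (\<gamma> (p n))"
        using p(3)[of n] by (simp add: power_mult_distrib[symmetric] mult.assoc[symmetric])
      then show ?thesis using np[of n] by (simp add: q_def \<gamma>_simps field_simps)
    qed
    have sn: "summable (\<lambda>n. norm (q n))" unfolding nq by (rule summable_geometric) simp
    then have s: "summable q" by (rule summable_norm_cancel)
    define w where "w = (\<Sum>n. q n)"
    have "bounded_linear chi"
      by (rule bounded_linear_intro[where K = 1])
        (simp_all add: chi_simps character_contractive[OF chi] scaleR_conv_of_real[where 'a = complex])
    from bounded_linear.suminf[OF this s] have chiw: "chi w = 0" by (simp add: w_def q)
    have "2 ^ n < Re (\<gamma> w)" for n
    proof -
      define r where "r m = (if m = n then 0 else q m)" for m
      have "(\<lambda>m. q m - (if m = n then q m else 0)) sums (w - q n)"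
        by (intro sums_diff sums_single) (simp add: w_def s summable_sums)
      moreover have "(\<lambda>m. q m - (if m = n then q m else 0)) = r"
        by (simp add: r_def fun_eq_iff)
      ultimately have "(\<Sum>m. r m) = w - q n" by (simp add: sums_iff)
      moreover have "positive_elem (\<Sum>m. r m)"
      proof (rule positive_suminf)
        show "positive_elem (r m)" for m
          using q(1)[of m] positive_scaleR[OF q(1), of 0] by (simp add: r_def)
        show "summable (\<lambda>m. norm (r m))"
          by (rule summable_comparison_test'[OF sn]) (simp add: r_def)
      qed
      ultimately have "0 \<le> Re (\<gamma> (w - q n))"
        by (intro nonneg) (simp_all add: chi_simps chiw q)
      then show ?thesis using big[of n] by (simp add: \<gamma>_simps)
    qed
    then show False using real_arch_pow[of 2 "Re (\<gamma> w)"] by (meson less_trans less_irrefl one_less_numeral_iff semiring_norm(76))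
  qed
  then obtain C where C: "\<And>p. positive_elem p \<Longrightarrow> chi p = 0 \<Longrightarrow> Re (\<gamma> p) \<le> C * norm p" by blast
  have "Re (\<gamma> p) \<le> max 0 C * norm p" if "positive_elem p" "chi p = 0" for p
    using C[OF that] mult_right_mono[of C "max 0 C" "norm p"] by simp
  with nonneg show ?thesis using that[of "max 0 C"] by simp
qed

text \<open>
  Since \<open>\<delta> 1 = 0\<close> and \<open>\<gamma> 1 = 0\<close>, it suffices to consider \<open>b = - k\<close> with \<open>k\<close> in the kernel, where the energy
  is \<open>Re (\<gamma> m)\<close> for \<open>m = (1 + k)\<^sup>\<star> (1 + k) - 1\<close>. An approximate unit \<open>u\<close> for the single self-adjoint element
  \<open>m\<close> gives \<open>0 \<le> Re \<gamma> (u (1 + m) u) = Re \<gamma> (u\<^sup>2) + Re \<gamma> (u m u)\<close>, in which the first term is at most \<open>C \<parallel>u\<parallel>\<^sup>2 \<le> 4 C\<close> and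
  the second tends to \<open>Re (\<gamma> m)\<close> by continuity on self-adjoint elements.
\<close>

lemma energy_bounded_below:
  obtains B where "\<And>b. - B \<le> (norm (\<delta> b))\<^sup>2 - 2 * Re (\<gamma> b)"
proof -
  obtain C where C: "0 \<le> C"
    "\<And>p. positive_elem p \<Longrightarrow> chi p = 0 \<Longrightarrow> 0 \<le> Re (\<gamma> p) \<and> Re (\<gamma> p) \<le> C * norm p"
    using positive_bounded by blast
  have sa_bound: "\<bar>Re (\<gamma> h)\<bar> \<le> C * norm h" if h: "h\<^sup>\<star> = h" "chi h = 0" for h
  proof -
    obtain p q where pq: "positive_elem p" "positive_elem q" "h = p - q"
      "norm p \<le> norm h" "norm q \<le> norm h" "chi p = 0" "chi q = 0"
      using selfadjoint_diff_positive[OF h(1)] chi h(2) by metis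
    have "C * norm p \<le> C * norm h" "C * norm q \<le> C * norm h"
      using pq C(1) by (simp_all add: mult_left_mono)
    moreover have "Re (\<gamma> h) = Re (\<gamma> p) - Re (\<gamma> q)" by (simp add: pq(3) \<gamma>_simps)
    ultimately show ?thesis using C(2)[of p] C(2)[of q] pq by linarith
  qed
  have key: "- (4 * C) \<le> Re (\<gamma> (k\<^sup>\<star> * k + k + k\<^sup>\<star>))" if k: "chi k = 0" for k
  proof (rule field_le_epsilon)
    fix e :: real assume e: "0 < e"
    define m where "m = k\<^sup>\<star> * k + k + k\<^sup>\<star>"
    have m: "m\<^sup>\<star> = m" by (simp add: m_def star_simps algebra_simps)
    have cm: "chi m = 0" by (simp add: m_def chi_simps k)
    \<comment> \<open>the accuracy of the approximate unit: the error below is at most \<open>3 C d\<close>; the summand 1 covers \<open>C = 0\<close>\<close>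
    define d where "d = e / (3 * C + 1)"
    have d: "0 < d" using e C(1) by (simp add: d_def)
    obtain R where R: "R\<^sup>\<star> = R" "R * (1 + (2 / d\<^sup>2) *\<^sub>R (m * m)) = 1" "norm R \<le> 1" "m * R = R * m"
      "(norm (m * R))\<^sup>2 \<le> 2 / (2 / d\<^sup>2)"
      using resolvent_of_square[OF m, of "2 / d\<^sup>2"] d by auto
    have nmR: "norm (m * R) \<le> d"
      by (rule power2_le_imp_le) (use R(5) d in simp_all)
    have "chi (R * (1 + (2 / d\<^sup>2) *\<^sub>R (m * m))) = 1" by (simp only: R(2) chi_simps)
    then have cR: "chi R = 1" by (simp add: chi_simps cm)
    define u where "u = 1 - R"
    have u: "u\<^sup>\<star> = u" "chi u = 0" by (simp_all add: u_def star_simps R chi_simps cR)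
    define y where "y = (1 + k) * u"
    have "y\<^sup>\<star> * y = u * (1 + m) * u"
      by (simp add: y_def star_simps u m_def algebra_simps)
    then have yy: "y\<^sup>\<star> * y = u * u + u * m * u" by (simp add: algebra_simps)
    have "chi y = 0" by (simp add: y_def chi_simps u)
    from Re_\<gamma>_star_self[OF this] have "0 \<le> Re (\<gamma> (u * u)) + Re (\<gamma> (u * m * u))"
      by (simp add: yy \<gamma>_add)
    moreover have "Re (\<gamma> (u * u)) \<le> 4 * C"
    proof -
      have "norm u \<le> 2" using norm_triangle_ineq4[of 1 R] R(3) by (simp add: u_def)
      then have "norm (u * u) \<le> 2 * 2"
        by (intro order_trans[OF norm_mult_ineq] mult_mono) simp_all
      then have "C * norm (u * u) \<le> C * 4" using C(1) by (intro mult_left_mono) simp_all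
      moreover have "positive_elem (u * u)" using u by (auto simp: positive_elem_def)
      ultimately show ?thesis using C(2)[of "u * u"] by (simp add: chi_simps u)
    qed
    moreover have "Re (\<gamma> (u * m * u)) \<le> Re (\<gamma> m) + e"
    proof -
      have eq: "m - u * m * u = 2 *\<^sub>R (m * R) - R * (m * R)"
        by (simp add: u_def algebra_simps R(4) scaleR_2)
      have "norm (m - u * m * u) \<le> 2 * d + 1 * d"
        unfolding eq
      proof (rule order_trans[OF norm_triangle_ineq4 add_mono])
        show "norm (R * (m * R)) \<le> 1 * d"
          by (rule order_trans[OF norm_mult_ineq mult_mono]) (use R(3) nmR in simp_all)
      qed (use nmR in simp)
      then have "C * norm (m - u * m * u) \<le> C * (3 * d)" using C(1) by (intro mult_left_mono) simp_all
      moreover have "\<bar>Re (\<gamma> (m - u * m * u))\<bar> \<le> C * norm (m - u * m * u)"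
        by (rule sa_bound) (simp_all add: star_simps u m mult.assoc chi_simps cm)
      moreover have "C * (3 * d) \<le> e" using e C(1) by (simp add: d_def field_simps)
      ultimately show ?thesis by (simp add: \<gamma>_simps)
    qed
    ultimately show "- (4 * C) \<le> Re (\<gamma> (k\<^sup>\<star> * k + k + k\<^sup>\<star>)) + e" by (simp add: m_def)
  qed
  have "- (4 * C) \<le> (norm (\<delta> b))\<^sup>2 - 2 * Re (\<gamma> b)" for b
  proof -
    define k where "k = chi b *\<^sub>C 1 - b"
    have k: "chi k = 0" "\<delta> k = - \<delta> b" "\<gamma> k = - \<gamma> b"
      by (simp_all add: k_def chi_simps \<delta>_simps \<gamma>_simps \<delta>_scaleC \<gamma>_scaleC \<delta>_one \<gamma>_one)
    show ?thesis
      using key[OF k(1)] Re_\<gamma>_star_self[OF k(1)] by (simp add: \<gamma>_add \<gamma>_star k)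
  qed
  then show ?thesis by (rule that)
qed

text \<open>
  Comparing the two expressions of \<open>\<gamma> (a\<^sup>\<star> b)\<close>, by the structure relation and as \<open>\<langle>\<xi>, \<delta> (a\<^sup>\<star> b)\<rangle>\<close>, shows that
  \<open>x = \<delta> a - (\<pi> a - chi a) \<xi>\<close> is orthogonal to the range of \<open>\<delta>\<close>. Since \<open>\<xi>\<close> is a limit of vectors \<open>\<delta> b\<close>
  and \<open>(\<pi> a - chi a) (\<delta> b)\<close> is a value of \<open>\<delta>\<close> as well, \<open>x\<close> is also in the closure of the range.
\<close>

lemma implementing_vector:
  obtains \<xi> where "\<And>a. \<gamma> a = cinner \<xi> (\<delta> a)" "\<And>a. \<delta> a = \<pi> a \<xi> - chi a *\<^sub>C \<xi>"
proof -
  obtain B where B: "\<And>b. - B \<le> (norm (\<delta> b))\<^sup>2 - 2 * Re (\<gamma> b)"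
    using energy_bounded_below by blast
  have lin: "linear \<delta>" "linear (\<lambda>b. Re (\<gamma> b))"
    by (rule linearI; simp add: \<delta>_add \<delta>_scaleC scaleR_scaleC \<gamma>_add \<gamma>_scaleC)+
  obtain \<xi> where cl: "\<xi> \<in> closure (range \<delta>)" and re: "\<And>b. Re (\<gamma> b) = inner \<xi> (\<delta> b)"
    using riesz_on_range[OF lin B] by blast
  have \<gamma>: "\<gamma> b = cinner \<xi> (\<delta> b)" for b
  proof (rule complex_eqI)
    show "Re (\<gamma> b) = Re (cinner \<xi> (\<delta> b))" using re[of b] by (simp add: inner_Re_cinner)
    show "Im (\<gamma> b) = Im (cinner \<xi> (\<delta> b))"
      using re[of "\<i> *\<^sub>C b"]
      by (simp add: inner_Re_cinner \<delta>_scaleC \<gamma>_scaleC cinner_scaleC_right)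
  qed
  have "\<delta> a = \<pi> a \<xi> - chi a *\<^sub>C \<xi>" for a
  proof -
    interpret \<pi>: bounded_linear "\<pi> a" by (rule \<pi>_bounded)
    let ?x = "\<delta> a - (\<pi> a \<xi> - chi a *\<^sub>C \<xi>)"
    have orth: "cinner ?x (\<delta> b) = 0" for b
    proof -
      have "cnj (\<gamma> a) * chi b + cnj (chi a) * \<gamma> b + cinner (\<delta> a) (\<delta> b) = cinner \<xi> (\<delta> (a\<^sup>\<star> * b))"
        by (simp only: \<gamma>_star_mult[symmetric] \<gamma>[of "a\<^sup>\<star> * b"])
      also have "\<dots> = cinner (\<pi> a \<xi>) (\<delta> b) + chi b * cnj (\<gamma> a)"
        by (simp add: \<delta>_mult cinner_simps \<pi>_adjoint \<gamma>[of "a\<^sup>\<star>", symmetric] \<gamma>_star)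
      finally show ?thesis by (simp add: cinner_simps \<gamma>[of b] algebra_simps)
    qed
    obtain X where X: "\<And>n. X n \<in> range \<delta>" "X \<longlonglongrightarrow> \<xi>"
      using cl unfolding closure_sequential by blast
    have "(\<lambda>n. inner ?x (\<delta> a - (\<pi> a (X n) - chi a *\<^sub>C X n))) \<longlonglongrightarrow> inner ?x ?x"
      by (intro tendsto_intros \<pi>.tendsto X(2) bounded_linear.tendsto[OF bounded_linear_scaleC_inner])
    moreover have "inner ?x (\<delta> a - (\<pi> a (X n) - chi a *\<^sub>C X n)) = 0" for n
    proof -
      obtain b where b: "X n = \<delta> b" using X(1)[of n] by blast
      have "\<delta> a - (\<pi> a (X n) - chi a *\<^sub>C X n)
          = \<delta> (a - (a * b - chi b *\<^sub>C a) + chi a *\<^sub>C b)"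
        by (simp add: b \<delta>_simps \<delta>_add \<delta>_scaleC \<delta>_mult)
      then show ?thesis by (simp only: inner_Re_cinner orth) simp
    qed
    ultimately have "(\<lambda>n. 0) \<longlonglongrightarrow> inner ?x ?x" by simp
    then have "inner ?x ?x = 0" by (rule LIMSEQ_unique[OF _ tendsto_const])
    then show ?thesis by simp
  qed
  with \<gamma> show ?thesis by (rule that)
qed

end

section \<open>Passage to the unitization\<close>

lemma mult_unitization_embed: "Unitization 0 a * Unitization 0 b = Unitization 0 (a * b)"
  by (simp add: unitization_defs)

lemma extend_character:
  fixes chi :: "'a::cstar_algebra \<Rightarrow> complex"
  assumes "character chi"
  shows "character (\<lambda>u. scalar_part u + chi (alg_part u))"
proof -
  have "scalar_part (1 :: 'a unitization) + chi (alg_part 1) \<noteq> 0"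
    by (simp add: one_unitization_def character_simps[OF assms])
  then show ?thesis
    unfolding character_def
    by (auto simp: unitization_defs character_simps[OF assms] algebra_simps)
qed

lemma character_scalar_part: "character (scalar_part :: 'a::cstar_algebra unitization \<Rightarrow> complex)"
proof -
  have "scalar_part (1 :: 'a unitization) \<noteq> 0" by (simp add: one_unitization_def)
  then show ?thesis unfolding character_def by (auto simp: unitization_defs)
qed

lemma character_star_nonunital:
  fixes chi :: "'a::cstar_algebra \<Rightarrow> complex"
  assumes "character chi"
  shows "chi (a\<^sup>\<star>) = cnj (chi a)"
  using character_star[OF extend_character[OF assms], of "Unitization 0 a"]
  by (simp add: unitization_defs)

text \<open>
  The decomposition in the unitization stays in the ideal, and so do the roots, because the ideal is the
  kernel of the character \<open>scalar_part\<close>.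
\<close>

lemma selfadjoint_diff_squares:
  fixes h :: "'a::cstar_algebra"
  assumes "h\<^sup>\<star> = h"
  obtains x y where "h = x\<^sup>\<star> * x - y\<^sup>\<star> * y"
proof -
  have "(Unitization 0 h)\<^sup>\<star> = Unitization 0 h" by (simp add: unitization_defs assms)
  then obtain p q where pq: "positive_elem p" "positive_elem q" "Unitization 0 h = p - q"
    "scalar_part p = 0" "scalar_part q = 0"
    using selfadjoint_diff_positive[of "Unitization 0 h"] character_scalar_part
    by (metis unitization.sel(1))
  have square: "\<exists>x. p = Unitization 0 (x\<^sup>\<star> * x)" if p: "positive_elem p" "scalar_part p = 0"
    for p :: "'a unitization"
  proof -
    obtain z where z: "z\<^sup>\<star> = z" "p = z * z" using p(1) by (auto simp: positive_elem_def)
    then have "scalar_part z * scalar_part z = 0" using p(2) by (simp add: times_unitization_def)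
    then have z0: "z = Unitization 0 (alg_part z)" by (simp add: unitization_eq_iff)
    then have "(alg_part z)\<^sup>\<star> = alg_part z"
      using z(1) by (metis star_unitization_def unitization.sel(2))
    then have "p = Unitization 0 ((alg_part z)\<^sup>\<star> * alg_part z)"
      using z(2) z0 mult_unitization_embed by metis
    then show ?thesis by blast
  qed
  obtain x y where "p = Unitization 0 (x\<^sup>\<star> * x)" "q = Unitization 0 (y\<^sup>\<star> * y)"
    using square pq by metis
  then have "h = x\<^sup>\<star> * x - y\<^sup>\<star> * y" using pq(3) by (simp add: minus_unitization_def)
  then show ?thesis by (rule that)
qed

lemma operator_linearD:
  assumes "operator_linear \<phi>"
  shows "bounded_linear (\<phi> a)" "\<phi> a (c *\<^sub>C v) = c *\<^sub>C \<phi> a v" "\<phi> a (v + w) = \<phi> a v + \<phi> a w"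
    "\<phi> (a + b) v = \<phi> a v + \<phi> b v" "\<phi> (c *\<^sub>C a) v = c *\<^sub>C \<phi> a v" "\<phi> 0 v = 0"
proof -
  show bl: "bounded_linear (\<phi> a)" and "\<phi> a (c *\<^sub>C v) = c *\<^sub>C \<phi> a v"
    and "\<phi> (a + b) v = \<phi> a v + \<phi> b v"
    and scale: "\<phi> (c *\<^sub>C a) v = c *\<^sub>C \<phi> a v" for a c v
    using assms by (auto simp: operator_linear_def bounded_clinear_def)
  show "\<phi> a (v + w) = \<phi> a v + \<phi> a w" using bl by (rule linear_simps(1))
  show "\<phi> 0 v = 0" using scale[of 0 0 v] by simp
qed

lemma Delta_simps: "Delta (v + w) = Delta v + Delta w" "Delta (c *\<^sub>C v) = c *\<^sub>C Delta v"
  "cinner (Delta v) w = cinner v (Delta w)"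
  by (simp_all add: Delta_def scaleC_prod_def cinner_prod_def split_beta)

text \<open>
  The structure relation for \<open>a\<^sup>\<star> b\<close> and for \<open>b\<^sup>\<star> a\<close> are adjoint to each other, so the claim holds for
  products \<open>a\<^sup>\<star> b\<close>; these span the algebra.
\<close>

lemma structure_map_adjoint:
  fixes chi :: "'a::cstar_algebra \<Rightarrow> complex"
    and \<phi> :: "'a \<Rightarrow> complex \<times> 'h::chilbert_space \<Rightarrow> complex \<times> 'h"
  assumes "structure_map chi \<phi>"
  shows "cinner (\<phi> x v) w = cinner v (\<phi> (x\<^sup>\<star>) w)"
proof -
  have lin: "operator_linear \<phi>"
    and prod: "\<phi> (a\<^sup>\<star> * b) v = chi b *\<^sub>C cadjoint (\<phi> a) v + cnj (chi a) *\<^sub>C \<phi> b v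
         + cadjoint (\<phi> a) (Delta (\<phi> b v))" for a b v
    using assms by (auto simp: structure_map_def)
  note \<phi> = operator_linearD[OF lin]
  have adj: "cinner (\<phi> a v) w = cinner v (cadjoint (\<phi> a) w)" for a v w
    by (rule cinner_cadjoint) (use lin in \<open>simp add: operator_linear_def\<close>)
  have adj': "cinner (cadjoint (\<phi> a) v) w = cinner v (\<phi> a w)" for a v w
    using adj[of a w v] cinner_commute[of "cadjoint (\<phi> a) v" w] cinner_commute[of v "\<phi> a w"] by simp
  define H where "H x \<longleftrightarrow> (\<forall>v w. cinner (\<phi> x v) w = cinner v (\<phi> (x\<^sup>\<star>) w))" for x
  have H_prod: "H (a\<^sup>\<star> * b)" for a b
    unfolding H_def star_mult star_star prod
    by (simp add: cinner_simps adj adj' Delta_simps)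
  have H_add: "H (x + y)" if "H x" "H y" for x y
    using that by (simp add: H_def star_add \<phi> cinner_simps)
  have H_scaleC: "H (c *\<^sub>C x)" if "H x" for c x
    using that by (simp add: H_def star_scaleC \<phi> cinner_simps)
  have H_sa: "H h" if h: "h\<^sup>\<star> = h" for h
  proof -
    obtain x y where "h = x\<^sup>\<star> * x - y\<^sup>\<star> * y" using selfadjoint_diff_squares[OF h] by blast
    then have "h = x\<^sup>\<star> * x + (- 1) *\<^sub>C (y\<^sup>\<star> * y)" by (simp add: scaleC_minus_left)
    then show ?thesis using H_add H_prod H_scaleC by metis
  qed
  have "H (x + x\<^sup>\<star>)" "H (\<i> *\<^sub>C (x - x\<^sup>\<star>))"
    by (rule H_sa; simp add: star_simps scaleC_simps add.commute)+
  moreover have "x = (1 / 2) *\<^sub>C (x + x\<^sup>\<star>) + (- \<i> / 2) *\<^sub>C \<i> *\<^sub>C (x - x\<^sup>\<star>)"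
  proof -
    have "(1 / 2) *\<^sub>C x + (1 / 2) *\<^sub>C x = x"
      by (simp flip: scaleC_add_left)
    then show ?thesis by (simp add: scaleC_simps)
  qed
  ultimately have "H x" using H_add H_scaleC by metis
  then show ?thesis unfolding H_def by blast
qed

lemma structure_map_mult:
  fixes chi :: "'a::cstar_algebra \<Rightarrow> complex"
    and \<phi> :: "'a \<Rightarrow> complex \<times> 'h::chilbert_space \<Rightarrow> complex \<times> 'h"
  assumes "character chi" "structure_map chi \<phi>"
  shows "\<phi> (a * b) v = chi b *\<^sub>C \<phi> a v + chi a *\<^sub>C \<phi> b v + \<phi> a (Delta (\<phi> b v))"
proof -
  have "cadjoint (\<phi> (a\<^sup>\<star>)) = \<phi> a"
    by (rule cadjoint_unique) (simp add: structure_map_adjoint[OF assms(2)] star_star)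
  moreover have "\<phi> (a\<^sup>\<star>\<^sup>\<star> * b) v = chi b *\<^sub>C cadjoint (\<phi> (a\<^sup>\<star>)) v + cnj (chi (a\<^sup>\<star>)) *\<^sub>C \<phi> b v
         + cadjoint (\<phi> (a\<^sup>\<star>)) (Delta (\<phi> b v))"
    using assms(2) unfolding structure_map_def by (auto dest!: spec[of _ "a\<^sup>\<star>"])
  ultimately show ?thesis by (simp add: star_star character_star_nonunital[OF assms(1)])
qed

lemma unital_implemented:
  fixes chi :: "'b::unital_cstar_algebra \<Rightarrow> complex"
    and \<psi> :: "'b \<Rightarrow> complex \<times> 'h::chilbert_space \<Rightarrow> complex \<times> 'h"
  assumes chi: "character chi"
    and lin: "operator_linear \<psi>"
    and adjoint: "\<And>a v w. cinner (\<psi> a v) w = cinner v (\<psi> (a\<^sup>\<star>) w)"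
    and mult: "\<And>a b v. \<psi> (a * b) v = chi b *\<^sub>C \<psi> a v + chi a *\<^sub>C \<psi> b v + \<psi> a (Delta (\<psi> b v))"
    and one: "\<And>v. \<psi> 1 v = 0"
  shows "implemented chi \<psi>"
proof -
  note \<psi> = operator_linearD[OF lin]
  define \<nu> where "\<nu> a \<eta> = snd (\<psi> a (0, \<eta>))" for a \<eta>
  define \<pi> where "\<pi> a \<eta> = \<nu> a \<eta> + chi a *\<^sub>C \<eta>" for a \<eta>
  define \<delta> where "\<delta> a = snd (\<psi> a (1, 0))" for a
  define \<gamma> where "\<gamma> a = fst (\<psi> a (1, 0))" for a
  note chi_simps = character_simps[OF chi] character_star[OF chi]
  have Delta: "Delta v = (0, snd v)" for v :: "complex \<times> 'h" by (simp add: Delta_def split_beta)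
  have row: "fst (\<psi> a (0, \<eta>)) = cinner (\<delta> (a\<^sup>\<star>)) \<eta>" for a \<eta>
    using adjoint[of "a\<^sup>\<star>" "(1, 0)" "(0, \<eta>)"]
    by (simp add: cinner_prod_def cinner_complex_def \<delta>_def star_star)
  have \<gamma>_star: "\<gamma> (a\<^sup>\<star>) = cnj (\<gamma> a)" for a
    using adjoint[of a "(1, 0)" "(1, 0)"] by (simp add: cinner_prod_def cinner_complex_def \<gamma>_def)
  have \<nu>_adjoint: "cinner (\<nu> a \<eta>) \<zeta> = cinner \<eta> (\<nu> (a\<^sup>\<star>) \<zeta>)" for a \<eta> \<zeta>
    using adjoint[of a "(0, \<eta>)" "(0, \<zeta>)"] by (simp add: cinner_prod_def cinner_complex_def \<nu>_def)
  have \<nu>_bounded: "bounded_linear (\<nu> a)" for a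
    unfolding \<nu>_def
    by (intro bounded_linear_compose[OF bounded_linear_snd] bounded_linear_compose[OF \<psi>(1)]
        bounded_linear_Pair bounded_linear_zero bounded_linear_ident)
  have \<pi>_bounded: "bounded_linear (\<pi> a)" for a
    unfolding \<pi>_def by (intro bounded_linear_add \<nu>_bounded bounded_linear_scaleC_inner)
  have \<pi>_adjoint: "cinner (\<pi> a \<eta>) \<zeta> = cinner \<eta> (\<pi> (a\<^sup>\<star>) \<zeta>)" for a \<eta> \<zeta>
    by (simp add: \<pi>_def cinner_simps \<nu>_adjoint chi_simps)
  have \<pi>_scaleC: "\<pi> a (c *\<^sub>C \<eta>) = c *\<^sub>C \<pi> a \<eta>" for a c \<eta>
    using \<psi>(2)[of a c "(0, \<eta>)"]
    by (simp add: \<pi>_def \<nu>_def scaleC_prod_def scaleC_simps mult.commute)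
  have \<pi>_mult: "\<pi> (a * b) \<eta> = \<pi> a (\<pi> b \<eta>)" for a b \<eta>
    using linear_simps(1)[OF \<nu>_bounded, of a] \<psi>(2)[of a "chi b" "(0, \<eta>)"]
    by (simp add: \<pi>_def \<nu>_def mult Delta scaleC_prod_def chi_simps scaleC_simps)
  interpret structure_components chi \<pi> \<delta> \<gamma>
  proof (rule structure_components.intro)
    show "character chi" by (rule chi)
    show "bounded_linear (\<pi> a)" for a by (rule \<pi>_bounded)
    show "cinner (\<pi> a \<eta>) \<zeta> = cinner \<eta> (\<pi> (a\<^sup>\<star>) \<zeta>)" for a \<eta> \<zeta> by (rule \<pi>_adjoint)
  qed (simp_all add: \<delta>_def \<gamma>_def \<pi>_def \<nu>_def \<psi> mult one
        Delta scaleC_prod_def scaleC_complex_def row chi_simps star_star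
        \<gamma>_star[unfolded \<gamma>_def] scaleC_simps algebra_simps)
  obtain \<xi> where \<xi>: "\<And>a. \<gamma> a = cinner \<xi> (\<delta> a)" "\<And>a. \<delta> a = \<pi> a \<xi> - chi a *\<^sub>C \<xi>"
    using implementing_vector by blast
  have rep: "cstar_representation \<pi>"
    unfolding cstar_representation_def operator_linear_def bounded_clinear_def
  proof (intro conjI allI)
    show "\<pi> (a\<^sup>\<star>) = cadjoint (\<pi> a)" for a
      by (rule cadjoint_unique[symmetric]) (rule \<pi>_adjoint)
    show "\<pi> (a * b) = \<pi> a \<circ> \<pi> b" for a b by (simp add: fun_eq_iff \<pi>_mult)
  qed (simp_all add: \<pi>_bounded \<pi>_scaleC, simp_all add: fun_eq_iff \<pi>_def \<nu>_def \<psi> chi_simps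
      scaleC_prod_def scaleC_simps algebra_simps)
  have "\<psi> a (z, \<eta>) = (bra \<xi> (\<pi> a (ket \<xi> z + \<eta>) - chi a *\<^sub>C (ket \<xi> z + \<eta>)),
      \<pi> a (ket \<xi> z + \<eta>) - chi a *\<^sub>C (ket \<xi> z + \<eta>))" for a z \<eta>
  proof -
    have w: "\<pi> a (ket \<xi> z + \<eta>) - chi a *\<^sub>C (ket \<xi> z + \<eta>) = z *\<^sub>C \<delta> a + \<nu> a \<eta>"
      unfolding \<xi>(2)[of a] ket_def
      by (simp add: linear_simps(1)[OF \<pi>_bounded] \<pi>_scaleC scaleC_simps mult.commute)
        (simp add: \<pi>_def)
    have "\<psi> a (z, \<eta>) = z *\<^sub>C \<psi> a (1, 0) + \<psi> a (0, \<eta>)"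
      unfolding \<psi>(2)[symmetric] \<psi>(3)[symmetric] by (simp add: scaleC_prod_def scaleC_complex_def)
    then have "snd (\<psi> a (z, \<eta>)) = z *\<^sub>C \<delta> a + \<nu> a \<eta>"
      and 1: "fst (\<psi> a (z, \<eta>)) = z * \<gamma> a + cinner (\<delta> (a\<^sup>\<star>)) \<eta>"
      by (simp_all add: \<delta>_def \<nu>_def \<gamma>_def row[unfolded \<delta>_def] scaleC_prod_def scaleC_complex_def)
    moreover have "cinner (\<delta> (a\<^sup>\<star>)) \<eta> = cinner \<xi> (\<nu> a \<eta>)"
      unfolding \<xi>(2) by (simp add: cinner_simps \<pi>_adjoint star_star chi_simps) (simp add: \<pi>_def cinner_simps)
    ultimately show ?thesis
      unfolding w by (simp add: prod_eq_iff bra_def cinner_simps \<xi>(1))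
  qed
  then show ?thesis
    unfolding implemented_def by (intro exI[of _ \<pi>] exI[of _ \<xi>]) (simp add: rep fun_eq_iff)
qed

theorem theoremA6:
  fixes chi :: "'a::cstar_algebra \<Rightarrow> complex"
    and \<phi> :: "'a \<Rightarrow> complex \<times> 'h::chilbert_space \<Rightarrow> complex \<times> 'h"
  assumes "character chi"
    and "structure_map chi \<phi>"
  shows "implemented chi \<phi>"
proof -
  have lin: "operator_linear \<phi>" using assms(2) by (simp add: structure_map_def)
  note \<phi> = operator_linearD[OF lin]
  define chi' where "chi' u = scalar_part u + chi (alg_part u)" for u
  define \<psi> where "\<psi> u = \<phi> (alg_part u)" for u
  have "implemented chi' \<psi>"
  proof (rule unital_implemented)
    show "character chi'" unfolding chi'_def using assms(1) by (rule extend_character)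
    show "operator_linear \<psi>"
      using lin unfolding operator_linear_def by (simp add: \<psi>_def unitization_defs)
    show "cinner (\<psi> u v) w = cinner v (\<psi> (u\<^sup>\<star>) w)" for u v w
      by (simp add: \<psi>_def unitization_defs structure_map_adjoint[OF assms(2)])
    show "\<psi> (u * u') v = chi' u' *\<^sub>C \<psi> u v + chi' u *\<^sub>C \<psi> u' v + \<psi> u (Delta (\<psi> u' v))" for u u' v
      by (simp add: \<psi>_def chi'_def unitization_defs \<phi> structure_map_mult[OF assms] scaleC_simps
          algebra_simps)
    show "\<psi> 1 v = 0" for v by (simp add: \<psi>_def one_unitization_def \<phi>)
  qed
  then obtain \<pi> \<xi> where \<pi>: "cstar_representation \<pi>"
    and eq: "\<And>u. \<psi> u = (\<lambda>\<eta>. (bra \<xi> \<eta>, \<eta>)) \<circ> (\<lambda>\<eta>. \<pi> u \<eta> - chi' u *\<^sub>C \<eta>) \<circ> (\<lambda>(z, \<eta>). ket \<xi> z + \<eta>)"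
    unfolding implemented_def by blast
  have embed: "Unitization 0 (a + b) = Unitization 0 a + Unitization 0 b"
    "Unitization 0 (c *\<^sub>C a) = c *\<^sub>C Unitization 0 a"
    "Unitization 0 (a * b) = Unitization 0 a * Unitization 0 b"
    "Unitization 0 (a\<^sup>\<star>) = (Unitization 0 a)\<^sup>\<star>" for a b :: 'a and c
    by (simp_all add: unitization_defs)
  have "cstar_representation (\<lambda>a. \<pi> (Unitization 0 a))"
    using \<pi> unfolding cstar_representation_def operator_linear_def embed by simp
  moreover have "\<phi> a = (\<lambda>\<eta>. (bra \<xi> \<eta>, \<eta>)) \<circ> (\<lambda>\<eta>. \<pi> (Unitization 0 a) \<eta> - chi a *\<^sub>C \<eta>)
      \<circ> (\<lambda>(z, \<eta>). ket \<xi> z + \<eta>)" for a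
    using eq[of "Unitization 0 a"] by (simp add: \<psi>_def chi'_def)
  ultimately show ?thesis unfolding implemented_def by blast
qed

end
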